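(* Let $\mathbb{E}$ be an instance of $3\mathrm{LIN}(\mathbb{Z}_2)$ with $n$ variables and $m$ equations. If $\mathbb{E}$ is unsatisfiable, then $\mathcal{S}(\mathbb{E})$ has a Lovász–Schrijver refutation of degree $6$ and size polynomial in $n$ and $m$.
   Context: An instance $\mathbb{E}$ of $3\mathrm{LIN}(\mathbb{Z}_2)$ with variables $X_1,\dots,X_n$ is a finite system of linear equations over $\mathbb{Z}_2$, each of the form $\sum_{i\in I}X_i=b$ with $I\subseteq[n]$, $|I|\le3$, $b\in\{0,1\}$; it is unsatisfiable if no assignment in $\mathbb{Z}_2$ satisfies all equations. For such an equation $E$, $\mathcal{S}(E)$ is the set of linear inequalities $\sum_{i\in T}\bar X_i+\sum_{i\in I\setminus T}X_i-1\ge0$ for all $T\subseteq I$ with $|T|\equiv 1-b\pmod 2$, in variables $X_i$ and twin variables $\bar X_i$; $\mathcal{S}(\mathbb{E})$ is the union of $\mathcal{S}(E)$ over all equations $E$ of $\mathbb{E}$. A Lovász–Schrijver (LS) refutation of a set of inequalities $H$ is a sequence of real polynomial inequalities ending in $-1\ge0$, each being a member of $H$, an axiom ($X_i^2-X_i=0$, $\bar X_i^2-\bar X_i=0$, $X_i+\bar X_i-1=0$, each equation counted as two inequalities, and $X_i\ge0$, $\bar X_i\ge0$, $1-X_i\ge0$, $1-\bar X_i\ge0$, $1\ge0$), or obtained from earlier ones by addition ($P\ge0,Q\ge0\vdash P+Q\ge0$) or by multiplication by a positive real or by a variable or twin variable ($P\ge0\vdash YP\ge0$). Degree is the maximum total degree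 of its polynomials; size is the number of symbols with polynomials written as explicit sums of monomials. *)

theory Defs
  imports
    Complex_Main
    "HOL-Library.Poly_Mapping"
    "HOL-Library.Z2"
    "HOL-Library.Extended_Nat"
    "HOL-Library.Log_Nat"
begin

text \<open>The pair \<open>(I, b)\<close> stands for the equation \<open>\<Sum>i\<in>I. X\<^sub>i = b\<close> over \<open>\<int>\<^sub>2\<close>.\<close>

type_synonym equation = "nat set \<times> bit"

definition is_3lin :: "nat \<Rightarrow> equation set \<Rightarrow> bool" where
  "is_3lin n E \<longleftrightarrow> finite E \<and> (\<forall>(I, b) \<in> E. I \<subseteq> {1..n} \<and> card I \<le> 3)"

definition satisfies :: "(nat \<Rightarrow> bit) \<Rightarrow> equation set \<Rightarrow> bool" where
  "satisfies x E \<longleftrightarrow> (\<forall>(I, b) \<in> E. (\<Sum>i\<in>I. x i) = b)"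

definition unsatisfiable :: "equation set \<Rightarrow> bool" where
  "unsatisfiable E \<longleftrightarrow> \<not> (\<exists>x. satisfies x E)"


text \<open>Real polynomials in the variables \<open>X\<^sub>i\<close> and their twins are finitely supported maps from
  monomials (exponent vectors) to coefficients.  A polynomial \<open>P\<close> also stands for the inequality
  \<open>P \<ge> 0\<close>.\<close>

datatype pvar = X nat | Xbar nat

type_synonym monomial = "pvar \<Rightarrow>\<^sub>0 nat"
type_synonym polynomial = "monomial \<Rightarrow>\<^sub>0 real"

definition Const :: "real \<Rightarrow> polynomial" where
  "Const c = Poly_Mapping.single 0 c"

definition Var :: "pvar \<Rightarrow> polynomial" where
  "Var v = Poly_Mapping.single (Poly_Mapping.single v 1) 1"

definition monomial_degree :: "monomial \<Rightarrow> nat" where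
  "monomial_degree \<mu> = (\<Sum>v \<in> Poly_Mapping.keys \<mu>. Poly_Mapping.lookup \<mu> v)"

definition total_degree :: "polynomial \<Rightarrow> nat" where
  "total_degree P = Max (insert 0 (monomial_degree ` Poly_Mapping.keys P))"


definition S_equation :: "equation \<Rightarrow> polynomial set" where
  "S_equation = (\<lambda>(I, b).
     {(\<Sum>i\<in>T. Var (Xbar i)) + (\<Sum>i\<in>I - T. Var (X i)) - 1 | T.
        T \<subseteq> I \<and> (of_nat (card T) :: bit) = 1 - b})"

definition S_system :: "equation set \<Rightarrow> polynomial set" where
  "S_system E = (\<Union>e\<in>E. S_equation e)"


definition pvars :: "nat \<Rightarrow> pvar set" where
  "pvars n = X ` {1..n} \<union> Xbar ` {1..n}"

definition ls_axioms :: "nat \<Rightarrow> polynomial set" where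
  "ls_axioms n =
     {Var v ^ 2 - Var v | v. v \<in> pvars n} \<union> {- (Var v ^ 2 - Var v) | v. v \<in> pvars n} \<union>
     {Var (X i) + Var (Xbar i) - 1 | i. i \<in> {1..n}} \<union>
     {- (Var (X i) + Var (Xbar i) - 1) | i. i \<in> {1..n}} \<union>
     {Var v | v. v \<in> pvars n} \<union> {1 - Var v | v. v \<in> pvars n} \<union> {1}"

text \<open>\<open>ls_step n H A Q\<close>: \<open>Q \<ge> 0\<close> may be written down once the inequalities in \<open>A\<close> have been
  derived.\<close>

definition ls_step :: "nat \<Rightarrow> polynomial set \<Rightarrow> polynomial set \<Rightarrow> polynomial \<Rightarrow> bool" where
  "ls_step n H A Q \<longleftrightarrow>
     Q \<in> H \<or> Q \<in> ls_axioms n \<or>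
     (\<exists>P\<in>A. \<exists>P'\<in>A. Q = P + P') \<or>
     (\<exists>P\<in>A. \<exists>c>0. Q = Const c * P) \<or>
     (\<exists>P\<in>A. \<exists>v\<in>pvars n. Q = Var v * P)"

definition ls_refutation :: "nat \<Rightarrow> polynomial set \<Rightarrow> polynomial list \<Rightarrow> bool" where
  "ls_refutation n H Ps \<longleftrightarrow>
     Ps \<noteq> [] \<and> last Ps = - 1 \<and>
     (\<forall>k < length Ps. ls_step n H (set (take k Ps)) (Ps ! k))"

definition proof_degree :: "polynomial list \<Rightarrow> nat" where
  "proof_degree Ps = Max (insert 0 (total_degree ` set Ps))"


text \<open>Coefficients are written as binary fractions: the digits of the numerator, a fraction bar and
  the digits of the denominator.  The infimum selects the shortest notation; it is \<open>\<infinity>\<close> for irrational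
  coefficients, which have no finite notation.\<close>

definition coeff_symbols :: "real \<Rightarrow> enat" where
  "coeff_symbols c =
     (INF (p, q) \<in> {(p :: int, q :: int). q > 0 \<and> c = of_int p / of_int q}.
        enat (floorlog 2 (nat \<bar>p\<bar>) + 1 + floorlog 2 (nat q)))"

text \<open>Each monomial is written as a sign, the absolute value of its coefficient, and its variables,
  each repeated according to its exponent; a variable counts as one symbol.  The remaining two
  symbols of an inequality are those of \<open>\<ge> 0\<close>.\<close>

definition inequality_symbols :: "polynomial \<Rightarrow> enat" where
  "inequality_symbols P =
     (if P = 0 then 1
      else (\<Sum>\<mu> \<in> Poly_Mapping.keys P.
              1 + coeff_symbols (Poly_Mapping.lookup P \<mu>) + enat (monomial_degree \<mu>))) + 2"

definition proof_size :: "polynomial list \<Rightarrow> enat" where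
  "proof_size Ps = (\<Sum>P\<leftarrow>Ps. inequality_symbols P)"

end

theory Submission
  imports Defs
begin

text \<open>By Gaussian elimination, an unsatisfiable system has a subset \<open>F\<close> of equations in which every
  variable occurs an even number of times and whose right-hand sides add up to \<open>1\<close>.  Each form
  \<open>D = \<Sum>i\<in>I. X i - b\<close> with \<open>(I, b) \<in> F\<close>, and each \<open>D = - 2 * X i\<close>, is even wherever its own
  equation holds, and a suitable sum of such forms is a constant \<open>- B\<close> with \<open>B\<close> odd.  For a form \<open>M\<close>
  with even values, \<open>(M - 2 * d) * (M - 2 * d - 2) \<ge> 0\<close> for all integers \<open>d\<close>.  The refutation
  derives these inequalities, for polynomially many \<open>d\<close>, for the successive partial sums \<open>M\<close>.  To
  pass from \<open>M\<close> to \<open>M + D\<close> it splits into the at most \<open>8\<close> cases for the variables of \<open>D\<close>; in each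
  case either \<open>D = 2 * y\<close>, which only shifts \<open>d\<close> by \<open>y\<close>, or an inequality of the system is violated.
  For \<open>M = - B\<close> and \<open>2 * d = - B - 1\<close> the inequality reads \<open>- 1 \<ge> 0\<close>.\<close>


subsection \<open>Linear systems over a field\<close>

text \<open>Gaussian elimination by induction on \<open>V\<close>. If \<open>v\<close> occurs in no
  equation it is dropped. Otherwise a pivot equation \<open>p\<close> containing \<open>v\<close> is
  subtracted, \<open>r j\<close> times, from each equation \<open>j\<close>; equation
  \<open>p\<close> itself becomes trivial. A certificate for the reduced system is then pulled back
  to the original one.\<close>

lemma linear_system_alternative:
  fixes a :: "'j \<Rightarrow> 'i \<Rightarrow> 'k::field"
  assumes "finite V" "finite J"
    and "\<nexists>x. \<forall>j\<in>J. (\<Sum>i\<in>V. a j i * x i) = b j"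
  shows "\<exists>c. (\<forall>i\<in>V. (\<Sum>j\<in>J. c j * a j i) = 0) \<and> (\<Sum>j\<in>J. c j * b j) = 1"
  using assms(1,3)
proof (induction V arbitrary: a b)
  case empty
  then obtain p where p: "p \<in> J" "b p \<noteq> 0" by force
  have "(\<Sum>j\<in>J. (if j = p then inverse (b p) else 0) * b j)
      = (\<Sum>j\<in>J. if j = p then inverse (b p) * b p else 0)"
    by (intro sum.cong) auto
  also have "\<dots> = 1" using p \<open>finite J\<close> by (simp add: sum.delta)
  finally show ?case by (intro exI[of _ "\<lambda>j. if j = p then inverse (b p) else 0"]) auto
next
  case (insert v V)
  show ?case
  proof (cases "\<forall>j\<in>J. a j v = 0")
    case True
    have "\<nexists>x. \<forall>j\<in>J. (\<Sum>i\<in>V. a j i * x i) = b j"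
      using insert.prems insert.hyps True by auto
    from insert.IH[OF this] obtain c where
      "\<forall>i\<in>V. (\<Sum>j\<in>J. c j * a j i) = 0" "(\<Sum>j\<in>J. c j * b j) = 1" by blast
    then show ?thesis using True by (intro exI[of _ c]) auto
  next
    case False
    then obtain p where p: "p \<in> J" "a p v \<noteq> 0" by blast
    define r where "r j = a j v / a p v" for j
    have r: "r j * a p v = a j v" for j using p by (simp add: r_def)
    let ?a = "\<lambda>j i. a j i - r j * a p i" and ?b = "\<lambda>j. b j - r j * b p"
    have "\<nexists>x. \<forall>j\<in>J. (\<Sum>i\<in>V. ?a j i * x i) = ?b j"
    proof
      assume "\<exists>x. \<forall>j\<in>J. (\<Sum>i\<in>V. ?a j i * x i) = ?b j"
      then obtain x where x: "\<And>j. j \<in> J \<Longrightarrow> (\<Sum>i\<in>V. ?a j i * x i) = ?b j" by blast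
      \<comment> \<open>Back substitution: the value of \<open>v\<close> is read off the pivot
        equation.\<close>
      define y where "y = x(v := (b p - (\<Sum>i\<in>V. a p i * x i)) / a p v)"
      have "(\<Sum>i\<in>insert v V. a j i * y i) = b j" if "j \<in> J" for j
      proof -
        have "(\<Sum>i\<in>insert v V. a j i * y i) = a j v * y v + (\<Sum>i\<in>V. a j i * x i)"
          using insert.hyps by (auto simp: y_def intro!: sum.cong)
        also have "a j v * y v = r j * (b p - (\<Sum>i\<in>V. a p i * x i))"
          by (simp add: y_def r_def)
        also have "(\<Sum>i\<in>V. a j i * x i) = ?b j + r j * (\<Sum>i\<in>V. a p i * x i)"
          using x[OF that] by (simp add: left_diff_distrib sum_subtractf sum_distrib_left mult.assoc algebra_simps)
        finally show ?thesis by (simp add: algebra_simps)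
      qed
      then show False using insert.prems by blast
    qed
    from insert.IH[OF this] obtain c where
      c: "\<And>i. i \<in> V \<Longrightarrow> (\<Sum>j\<in>J. c j * ?a j i) = 0" "(\<Sum>j\<in>J. c j * ?b j) = 1" by blast
    define s where "s = (\<Sum>j\<in>J. c j * r j)"
    \<comment> \<open>The reduced combination uses the pivot equation \<open>- s\<close> times in
      addition to \<open>c p\<close>; \<open>d\<close> collects these multiples in the coefficient
      of \<open>p\<close>.\<close>
    define d where "d j = c j - (if j = p then s else 0)" for j
    have d: "(\<Sum>j\<in>J. d j * f j) = (\<Sum>j\<in>J. c j * (f j - r j * f p))" for f
    proof -
      have "(\<Sum>j\<in>J. d j * f j) = (\<Sum>j\<in>J. c j * f j) - (\<Sum>j\<in>J. if j = p then s * f p else 0)"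
        unfolding sum_subtractf[symmetric] by (intro sum.cong) (auto simp: d_def algebra_simps)
      also have "(\<Sum>j\<in>J. if j = p then s * f p else 0) = s * f p"
        using p \<open>finite J\<close> by (simp add: sum.delta)
      finally show ?thesis
        by (simp add: s_def right_diff_distrib sum_subtractf sum_distrib_right mult.assoc)
    qed
    have "(\<Sum>j\<in>J. d j * a j v) = 0" by (simp add: d r)
    then show ?thesis using c by (intro exI[of _ d]) (auto simp: d)
  qed
qed


subsection \<open>Size of polynomials\<close>

definition l1_norm :: "polynomial \<Rightarrow> real" where
  "l1_norm P = (\<Sum>\<mu>\<in>Poly_Mapping.keys P. \<bar>Poly_Mapping.lookup P \<mu>\<bar>)"

lemma l1_norm_superset:
  assumes "finite S" "Poly_Mapping.keys P \<subseteq> S"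
  shows "l1_norm P = (\<Sum>\<mu>\<in>S. \<bar>Poly_Mapping.lookup P \<mu>\<bar>)"
  unfolding l1_norm_def using assms
  by (intro sum.mono_neutral_left) (auto simp: in_keys_iff)

lemma l1_norm_zero [simp]: "l1_norm 0 = 0"
  by (simp add: l1_norm_def)

lemma l1_norm_single [simp]: "l1_norm (Poly_Mapping.single \<mu> c) = \<bar>c\<bar>"
  by (simp add: l1_norm_def)

lemma l1_norm_add: "l1_norm (P + Q) \<le> l1_norm P + l1_norm Q"
proof -
  let ?S = "Poly_Mapping.keys P \<union> Poly_Mapping.keys Q"
  have "l1_norm (P + Q) = (\<Sum>\<mu>\<in>?S. \<bar>Poly_Mapping.lookup (P + Q) \<mu>\<bar>)"
    by (intro l1_norm_superset) (auto dest: subsetD[OF keys_add])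
  also have "\<dots> \<le> (\<Sum>\<mu>\<in>?S. \<bar>Poly_Mapping.lookup P \<mu>\<bar> + \<bar>Poly_Mapping.lookup Q \<mu>\<bar>)"
    by (intro sum_mono) (simp add: lookup_add abs_triangle_ineq)
  also have "\<dots> = l1_norm P + l1_norm Q"
    by (simp add: sum.distrib l1_norm_superset[of ?S])
  finally show ?thesis .
qed

lemma l1_norm_sum: "l1_norm (sum f A) \<le> (\<Sum>x\<in>A. l1_norm (f x))"
proof (induction A rule: infinite_finite_induct)
  case (insert x A)
  then show ?case using l1_norm_add[of "f x" "sum f A"] by simp
qed auto

lemma sum_single_lookup:
  fixes P :: "'a \<Rightarrow>\<^sub>0 'b::comm_monoid_add"
  shows "(\<Sum>\<mu>\<in>Poly_Mapping.keys P. Poly_Mapping.single \<mu> (Poly_Mapping.lookup P \<mu>)) = P"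
proof (rule poly_mapping_eqI)
  fix k
  have "(\<Sum>\<mu>\<in>Poly_Mapping.keys P. if \<mu> = k then Poly_Mapping.lookup P \<mu> else 0)
      = Poly_Mapping.lookup P k"
    by (simp add: sum.delta in_keys_iff)
  then show "Poly_Mapping.lookup (\<Sum>\<mu>\<in>Poly_Mapping.keys P.
      Poly_Mapping.single \<mu> (Poly_Mapping.lookup P \<mu>)) k = Poly_Mapping.lookup P k"
    by (simp add: lookup_sum lookup_single when_def)
qed

lemma mult_eq_sum_single:
  fixes P Q :: polynomial
  shows "P * Q = (\<Sum>\<mu>\<in>Poly_Mapping.keys P. \<Sum>\<nu>\<in>Poly_Mapping.keys Q.
     Poly_Mapping.single (\<mu> + \<nu>) (Poly_Mapping.lookup P \<mu> * Poly_Mapping.lookup Q \<nu>))"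
proof -
  have "P * Q = (\<Sum>\<mu>\<in>Poly_Mapping.keys P. Poly_Mapping.single \<mu> (Poly_Mapping.lookup P \<mu>)) *
     (\<Sum>\<nu>\<in>Poly_Mapping.keys Q. Poly_Mapping.single \<nu> (Poly_Mapping.lookup Q \<nu>))"
    by (simp only: sum_single_lookup)
  then show ?thesis by (simp only: sum_product mult_single)
qed

text \<open>Merging and cancellation of monomials after expanding the product can only lower the
  norm.\<close>

lemma l1_norm_mult: "l1_norm (P * Q) \<le> l1_norm P * l1_norm Q"
proof -
  have "l1_norm (P * Q) \<le> (\<Sum>\<mu>\<in>Poly_Mapping.keys P. \<Sum>\<nu>\<in>Poly_Mapping.keys Q.
     l1_norm (Poly_Mapping.single (\<mu> + \<nu>) (Poly_Mapping.lookup P \<mu> * Poly_Mapping.lookup Q \<nu>)))"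
    unfolding mult_eq_sum_single by (intro order_trans[OF l1_norm_sum] sum_mono order_refl)
  also have "\<dots> = l1_norm P * l1_norm Q"
    by (simp add: l1_norm_def[of P] l1_norm_def[of Q] sum_product abs_mult)
  finally show ?thesis .
qed

section \<open>Integrality of coefficients and degree\<close>

definition integer_coeffs :: "polynomial \<Rightarrow> bool" where
  "integer_coeffs P \<longleftrightarrow> (\<forall>\<mu>. Poly_Mapping.lookup P \<mu> \<in> \<int>)"

lemma integer_coeffs_add: "integer_coeffs P \<Longrightarrow> integer_coeffs Q \<Longrightarrow> integer_coeffs (P + Q)"
  by (simp add: integer_coeffs_def lookup_add)

lemma integer_coeffs_mult: "integer_coeffs P \<Longrightarrow> integer_coeffs Q \<Longrightarrow> integer_coeffs (P * Q)"
  unfolding mult_eq_sum_single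
  by (auto simp: integer_coeffs_def lookup_sum lookup_single when_def intro!: Ints_sum)

lemma total_degree_le_iff:
  "total_degree P \<le> e \<longleftrightarrow> (\<forall>\<mu>\<in>Poly_Mapping.keys P. monomial_degree \<mu> \<le> e)"
  by (simp add: total_degree_def)

lemma monomial_degree_superset:
  assumes "finite S" "Poly_Mapping.keys \<mu> \<subseteq> S"
  shows "monomial_degree \<mu> = (\<Sum>v\<in>S. Poly_Mapping.lookup \<mu> v)"
  unfolding monomial_degree_def using assms
  by (intro sum.mono_neutral_left) (auto simp: in_keys_iff)

lemma monomial_degree_add: "monomial_degree (\<mu> + \<nu>) = monomial_degree \<mu> + monomial_degree \<nu>"
proof -
  let ?S = "Poly_Mapping.keys \<mu> \<union> Poly_Mapping.keys \<nu>"
  have "monomial_degree (\<mu> + \<nu>) = (\<Sum>v\<in>?S. Poly_Mapping.lookup (\<mu> + \<nu>) v)"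
    by (intro monomial_degree_superset) (auto dest: subsetD[OF keys_add])
  then show ?thesis
    by (simp add: lookup_add sum.distrib monomial_degree_superset[of ?S])
qed

lemma total_degree_add:
  "total_degree P \<le> e \<Longrightarrow> total_degree Q \<le> e \<Longrightarrow> total_degree (P + Q) \<le> e"
  by (auto simp: total_degree_le_iff dest: subsetD[OF keys_add])

lemma total_degree_mult:
  assumes "total_degree P \<le> e" "total_degree Q \<le> f"
  shows "total_degree (P * Q) \<le> e + f"
  unfolding total_degree_le_iff
proof
  fix \<mu> assume "\<mu> \<in> Poly_Mapping.keys (P * Q)"
  then obtain a b where "\<mu> = a + b" "a \<in> Poly_Mapping.keys P" "b \<in> Poly_Mapping.keys Q"
    using keys_mult[of P Q] by auto
  then show "monomial_degree \<mu> \<le> e + f"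
    using assms by (auto simp: monomial_degree_add total_degree_le_iff intro!: add_mono)
qed

lemma total_degree_of_int [simp]: "total_degree (of_int c) = 0"
proof -
  have "total_degree (Poly_Mapping.single 0 (of_int c)) \<le> 0"
    by (auto simp only: total_degree_le_iff keys_single monomial_degree_def split: if_splits) simp
  then show ?thesis by simp
qed

lemma total_degree_Var: "total_degree (Var v) \<le> 1"
  by (simp add: total_degree_le_iff Var_def monomial_degree_def)

text \<open>Written polynomials with integer coefficients: the first index bounds the sum of the absolute
  values of the coefficients, hence both the number of monomials and the coefficients, and the
  second one bounds the degree.\<close>

inductive weighted :: "nat \<Rightarrow> nat \<Rightarrow> nat \<Rightarrow> polynomial \<Rightarrow> bool" for n where
  const: "nat \<bar>c\<bar> + 3 \<le> w \<Longrightarrow> weighted n w e (of_int c)"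
| var: "v \<in> pvars n \<Longrightarrow> 2 \<le> w \<Longrightarrow> 1 \<le> e \<Longrightarrow> weighted n w e (Var v)"
| add: "weighted n w1 e P \<Longrightarrow> weighted n w2 e Q \<Longrightarrow> w1 + w2 + 1 \<le> w \<Longrightarrow> weighted n w e (P + Q)"
| mult: "weighted n w1 e1 P \<Longrightarrow> weighted n w2 e2 Q \<Longrightarrow> w1 * w2 \<le> w \<Longrightarrow> e1 + e2 \<le> e \<Longrightarrow>
    weighted n w e (P * Q)"

text \<open>The slack in the rules for constants and variables serves this lower bound. It makes
  products of weights large enough to absorb the one extra line that each derivation rule
  costs.\<close>

lemma weighted_pos: "weighted n w e P \<Longrightarrow> 2 \<le> w"
proof (induction rule: weighted.induct)
  case (mult w1 e1 P w2 e2 Q w e)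
  have "2 * 2 \<le> w1 * w2" by (intro mult_le_mono mult.IH)
  then show ?case using mult by linarith
qed auto

lemma weighted_mono:
  "weighted n w e P \<Longrightarrow> w \<le> w' \<Longrightarrow> e \<le> e' \<Longrightarrow> weighted n w' e' P"
proof (induction arbitrary: w' e' rule: weighted.induct)
  case (add w1 e P w2 Q w)
  show ?case by (rule weighted.add[OF add.IH(1)[of w1 e'] add.IH(2)[of w2 e']]) (use add in auto)
next
  case (mult w1 e1 P w2 e2 Q w e)
  show ?case by (rule weighted.mult[OF mult.hyps(1,2)]) (use mult in auto)
qed (auto intro: weighted.intros)

lemma weighted_bounds:
  assumes "weighted n w e P"
  shows "l1_norm P \<le> w" "total_degree P \<le> e" "integer_coeffs P"
proof -
  have "l1_norm P \<le> w \<and> total_degree P \<le> e \<and> integer_coeffs P"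
    using assms
  proof (induction rule: weighted.induct)
    case (const c w e)
    have "l1_norm (Poly_Mapping.single 0 (of_int c)) \<le> w"
      unfolding l1_norm_single using const by linarith
    then show ?case by (auto simp: integer_coeffs_def lookup_of_int when_def)
  next
    case (var v w e)
    then show ?case using total_degree_Var[of v]
      by (auto simp: Var_def integer_coeffs_def lookup_single when_def)
  next
    case (add w1 e P w2 Q w)
    then show ?case using l1_norm_add[of P Q]
      by (auto intro: integer_coeffs_add total_degree_add)
  next
    case (mult w1 e1 P w2 e2 Q w e)
    have "l1_norm (P * Q) \<le> real w1 * real w2"
      using mult.IH by (intro order_trans[OF l1_norm_mult] mult_mono) (auto simp: l1_norm_def)
    also have "\<dots> \<le> w" using mult.hyps by (metis of_nat_le_iff of_nat_mult)
    finally show ?case using mult total_degree_mult[of P e1 Q e2]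
      by (auto intro: integer_coeffs_mult)
  qed
  then show "l1_norm P \<le> w" "total_degree P \<le> e" "integer_coeffs P" by auto
qed

lemma floorlog_2_le: "floorlog 2 k \<le> k"
  by (intro floorlog_leI) auto

text \<open>The notation with denominator \<open>1\<close> is one of the candidates of the infimum.
  Bounding the binary length by the value is crude, but enough when the coefficients themselves are
  polynomially bounded.\<close>

lemma coeff_symbols_le:
  assumes "c \<in> \<int>"
  shows "coeff_symbols c \<le> enat (nat \<lfloor>\<bar>c\<bar>\<rfloor> + 2)"
proof -
  obtain p where p: "c = of_int p" using assms by (auto elim: Ints_cases)
  have f1: "floorlog 2 (nat 1) \<le> 1" using floorlog_2_le[of 1] by simp
  have "coeff_symbols c \<le> enat (floorlog 2 (nat \<bar>p\<bar>) + 1 + floorlog 2 (nat 1))"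
    unfolding coeff_symbols_def by (rule INF_lower2[of "(p, 1)"]) (auto simp: p)
  also have "\<dots> \<le> enat (nat \<bar>p\<bar> + 2)"
    using floorlog_2_le[of "nat \<bar>p\<bar>"] f1 by simp
  also have "nat \<bar>p\<bar> = nat \<lfloor>\<bar>c\<bar>\<rfloor>" by (simp add: p flip: of_int_abs)
  finally show ?thesis .
qed

lemma enat_sum: "enat (sum f A) = (\<Sum>x\<in>A. enat (f x))"
  by (induction A rule: infinite_finite_induct) (auto simp: zero_enat_def simp flip: plus_enat_simps)

text \<open>A coefficient that occurs is a nonzero integer, so the constant cost and the degree of
  its monomial can be charged to its absolute value; summation gives the norm. The final
  \<open>3\<close> covers the symbols of \<open>\<ge> 0\<close> and the zero polynomial.\<close>

lemma inequality_symbols_le: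
  assumes "weighted n w e P"
  shows "inequality_symbols P \<le> enat ((4 + e) * w + 3)"
proof -
  note b = weighted_bounds[OF assms]
  let ?c = "\<lambda>\<mu>. nat \<lfloor>\<bar>Poly_Mapping.lookup P \<mu>\<bar>\<rfloor>"
  have int: "Poly_Mapping.lookup P \<mu> \<in> \<int>" for \<mu> using b(3) by (simp add: integer_coeffs_def)
  have c: "real (?c \<mu>) = \<bar>Poly_Mapping.lookup P \<mu>\<bar>" for \<mu>
    using int[of \<mu>] by (auto elim!: Ints_cases simp flip: of_int_abs)
  have "(\<Sum>\<mu>\<in>Poly_Mapping.keys P. 1 + coeff_symbols (Poly_Mapping.lookup P \<mu>)
      + enat (monomial_degree \<mu>)) \<le> (\<Sum>\<mu>\<in>Poly_Mapping.keys P. enat ((4 + e) * ?c \<mu>))"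
  proof (rule sum_mono)
    fix \<mu> assume \<mu>: "\<mu> \<in> Poly_Mapping.keys P"
    have "1 + coeff_symbols (Poly_Mapping.lookup P \<mu>) + enat (monomial_degree \<mu>)
        \<le> 1 + enat (?c \<mu> + 2) + enat e"
      using coeff_symbols_le[OF int[of \<mu>]] b(2) \<mu>
      by (intro add_mono) (auto simp: total_degree_le_iff)
    also have "\<dots> = enat (?c \<mu> + 3 + e)" by (simp add: one_enat_def)
    also have "?c \<mu> + 3 + e \<le> (4 + e) * ?c \<mu>"
    proof -
      have "Poly_Mapping.lookup P \<mu> \<noteq> 0" using \<mu> by (simp add: in_keys_iff)
      then have "1 \<le> ?c \<mu>" using c[of \<mu>] by (cases "?c \<mu>") auto
      then have "(3 + e) * 1 \<le> (3 + e) * ?c \<mu>" by (intro mult_le_mono2)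
      then show ?thesis by (simp add: algebra_simps)
    qed
    finally show "1 + coeff_symbols (Poly_Mapping.lookup P \<mu>) + enat (monomial_degree \<mu>)
        \<le> enat ((4 + e) * ?c \<mu>)" by simp
  qed
  also have "\<dots> = enat ((4 + e) * (\<Sum>\<mu>\<in>Poly_Mapping.keys P. ?c \<mu>))"
    by (simp only: enat_sum sum_distrib_left)
  also have "\<dots> \<le> enat ((4 + e) * w)"
  proof -
    have "real (\<Sum>\<mu>\<in>Poly_Mapping.keys P. ?c \<mu>) \<le> real w"
      using b(1) by (simp only: of_nat_sum c l1_norm_def)
    then have "(\<Sum>\<mu>\<in>Poly_Mapping.keys P. ?c \<mu>) \<le> w" by (simp only: of_nat_le_iff)
    then show ?thesis by (simp only: enat_ord_simps mult_le_mono2)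
  qed
  finally have s: "(\<Sum>\<mu>\<in>Poly_Mapping.keys P. 1 + coeff_symbols (Poly_Mapping.lookup P \<mu>)
      + enat (monomial_degree \<mu>)) \<le> enat ((4 + e) * w)" .
  show ?thesis
  proof (cases "P = 0")
    case True
    then show ?thesis by (simp add: inequality_symbols_def one_enat_def numeral_eq_enat)
  next
    case False
    have "inequality_symbols P \<le> enat ((4 + e) * w) + 2"
      unfolding inequality_symbols_def using s False by (simp add: add_right_mono)
    also have "\<dots> \<le> enat ((4 + e) * w + 3)" by (simp add: numeral_eq_enat)
    finally show ?thesis .
  qed
qed


subsection \<open>Weighted derivations\<close>

text \<open>Tree-like derivations of bounded degree from \<open>K\<close> and the axioms.  The weight bounds both the
  number of lines and the weight of each line.\<close>

inductive derives :: "nat \<Rightarrow> polynomial set \<Rightarrow> nat \<Rightarrow> nat \<Rightarrow> polynomial \<Rightarrow> bool" for n K where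
  base: "P \<in> K \<union> ls_axioms n \<Longrightarrow> weighted n w e P \<Longrightarrow> derives n K w e P"
| add: "derives n K w1 e P \<Longrightarrow> derives n K w2 e Q \<Longrightarrow> w1 + w2 + 1 \<le> w \<Longrightarrow>
    derives n K w e (P + Q)"
| scale: "derives n K w1 e P \<Longrightarrow> 0 < c \<Longrightarrow> (c + 3) * w1 \<le> w \<Longrightarrow>
    derives n K w e (of_nat c * P)"
| times_var: "derives n K w1 e1 P \<Longrightarrow> v \<in> pvars n \<Longrightarrow> 2 * w1 \<le> w \<Longrightarrow> e1 + 1 \<le> e \<Longrightarrow>
    derives n K w e (Var v * P)"

text \<open>The factors \<open>c + 3\<close> and \<open>2\<close> in \<open>scale\<close> and
  \<open>times_var\<close> are the weights of the multipliers, so the product rule of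
  \<open>weighted\<close> applies.\<close>

lemma derives_weighted: "derives n K w e P \<Longrightarrow> weighted n w e P"
proof (induction rule: derives.induct)
  case (scale w1 e P c w)
  then show ?case
    using weighted.mult[OF weighted.const[of "int c" "c + 3" n 0] scale.IH, of w e] by simp
next
  case (times_var w1 e1 P v w e)
  then show ?case
    using weighted.mult[OF weighted.var[of v n 2 1] times_var.IH, of w e] by simp
qed (auto intro: weighted.add)

lemma derives_mono:
  "derives n K w e P \<Longrightarrow> w \<le> w' \<Longrightarrow> e \<le> e' \<Longrightarrow> derives n K w' e' P"
proof (induction arbitrary: w' e' rule: derives.induct)
  case (add w1 e P w2 Q w)
  show ?case by (rule derives.add[OF add.IH(1)[of w1 e'] add.IH(2)[of w2 e']]) (use add in auto)
next
  case (scale w1 e P c w)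
  show ?case by (rule derives.scale[OF scale.IH[of w1 e']]) (use scale in auto)
next
  case (times_var w1 e1 P v w e)
  show ?case by (rule derives.times_var[OF times_var.hyps(1)]) (use times_var in auto)
qed (auto intro: derives.base weighted_mono)

section \<open>From tree-like derivations to sequences of lines\<close>

definition ls_derivation :: "nat \<Rightarrow> polynomial set \<Rightarrow> polynomial set \<Rightarrow> polynomial list \<Rightarrow> bool" where
  "ls_derivation n H A Ps \<longleftrightarrow> (\<forall>k < length Ps. ls_step n H (A \<union> set (take k Ps)) (Ps ! k))"

lemma ls_step_mono: "ls_step n H A Q \<Longrightarrow> A \<subseteq> B \<Longrightarrow> ls_step n H B Q"
  unfolding ls_step_def by blast

lemma ls_derivation_Nil [simp]: "ls_derivation n H A []"
  by (simp add: ls_derivation_def)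

lemma ls_derivation_append:
  assumes "ls_derivation n H A Ps" "ls_derivation n H B Qs" "B \<subseteq> A \<union> set Ps"
  shows "ls_derivation n H A (Ps @ Qs)"
  unfolding ls_derivation_def
proof (intro allI impI)
  fix k assume k: "k < length (Ps @ Qs)"
  show "ls_step n H (A \<union> set (take k (Ps @ Qs))) ((Ps @ Qs) ! k)"
  proof (cases "k < length Ps")
    case True
    then show ?thesis using assms(1) by (auto simp: ls_derivation_def nth_append)
  next
    case False
    then have "ls_step n H (B \<union> set (take (k - length Ps) Qs)) (Qs ! (k - length Ps))"
      using assms(2) k by (auto simp: ls_derivation_def)
    then show ?thesis using False assms(3)
      by (auto simp: nth_append intro: ls_step_mono)
  qed
qed

lemma ls_derivation_single: "ls_step n H A Q \<Longrightarrow> ls_derivation n H A [Q]"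
  by (simp add: ls_derivation_def)

text \<open>The tree is written out in postorder: the lists for the premises, then one line for the
  conclusion. Leaves in \<open>A\<close> cost no line, since they count as already derived.\<close>

lemma derives_imp_ls_derivation:
  assumes "derives n (H \<union> A) w e Q"
  shows "\<exists>Ps. ls_derivation n H A Ps \<and> Q \<in> A \<union> set Ps \<and> length Ps \<le> w \<and>
    (\<forall>P\<in>set Ps. weighted n w e P)"
  using assms
proof (induction rule: derives.induct)
  case (base P w e)
  show ?case
  proof (cases "P \<in> A")
    case True
    then show ?thesis by (intro exI[of _ "[]"]) simp
  next
    case False
    then show ?thesis using base weighted_pos[OF base(2)]
      by (intro exI[of _ "[P]"] conjI ls_derivation_single) (auto simp: ls_step_def)
  qed
next
  case (add w1 e P w2 Q w)
  obtain Ps where Ps: "ls_derivation n H A Ps" "P \<in> A \<union> set Ps" "length Ps \<le> w1"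
    "\<forall>P\<in>set Ps. weighted n w1 e P" using add.IH(1) by blast
  obtain Qs where Qs: "ls_derivation n H A Qs" "Q \<in> A \<union> set Qs" "length Qs \<le> w2"
    "\<forall>P\<in>set Qs. weighted n w2 e P" using add.IH(2) by blast
  have "ls_derivation n H A ((Ps @ Qs) @ [P + Q])"
    using Ps Qs by (intro ls_derivation_append[OF ls_derivation_append[OF Ps(1) Qs(1)]
      ls_derivation_single[of n H "{P, Q}"]]) (auto simp: ls_step_def)
  moreover have "weighted n w e (P + Q)"
    using add by (auto intro: weighted.add derives_weighted)
  moreover have "\<forall>R\<in>set Ps \<union> set Qs. weighted n w e R"
    using Ps(4) Qs(4) add.hyps
    by (auto intro: weighted_mono[of n w1 e _ w e] weighted_mono[of n w2 e _ w e])
  ultimately show ?case using Ps Qs add.hyps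
    by (intro exI[of _ "(Ps @ Qs) @ [P + Q]"]) auto
next
  case (scale w1 e P c w)
  obtain Ps where Ps: "ls_derivation n H A Ps" "P \<in> A \<union> set Ps" "length Ps \<le> w1"
    "\<forall>P\<in>set Ps. weighted n w1 e P" using scale.IH by blast
  have w1: "2 \<le> w1" using scale.hyps by (auto intro: weighted_pos derives_weighted)
  have "4 * w1 \<le> (c + 3) * w1" using scale.hyps by (intro mult_le_mono) auto
  then have w: "w1 + 1 \<le> w" using scale.hyps w1 by linarith
  have "of_nat c * P = Const (real c) * P"
    by (simp add: Const_def)
  then have "ls_step n H {P} (of_nat c * P)"
    using scale.hyps unfolding ls_step_def by (metis of_nat_0_less_iff singletonI)
  then have "ls_derivation n H A (Ps @ [of_nat c * P])"
    using Ps by (intro ls_derivation_append[OF Ps(1) ls_derivation_single]) auto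
  moreover have "weighted n w e (of_nat c * P)"
    using scale by (auto intro: derives.scale derives_weighted)
  moreover have "\<forall>R\<in>set Ps. weighted n w e R"
    using Ps(4) w by (auto intro: weighted_mono[of n w1 e _ w e])
  ultimately show ?case using Ps w
    by (intro exI[of _ "Ps @ [of_nat c * P]"]) auto
next
  case (times_var w1 e1 P v w e)
  obtain Ps where Ps: "ls_derivation n H A Ps" "P \<in> A \<union> set Ps" "length Ps \<le> w1"
    "\<forall>P\<in>set Ps. weighted n w1 e1 P" using times_var.IH by blast
  have w1: "2 \<le> w1" using times_var.hyps by (auto intro: weighted_pos derives_weighted)
  have "ls_derivation n H A (Ps @ [Var v * P])"
    using Ps times_var.hyps by (intro ls_derivation_append[OF Ps(1)
      ls_derivation_single[of n H "{P}"]]) (auto simp: ls_step_def)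
  moreover have "weighted n w e (Var v * P)"
    using derives.times_var[OF times_var.hyps] by (rule derives_weighted)
  moreover have "\<forall>R\<in>set Ps. weighted n w e R"
    using Ps(4) times_var.hyps by (auto intro: weighted_mono[of n w1 e1 _ w e])
  ultimately show ?case using Ps w1 times_var.hyps
    by (intro exI[of _ "Ps @ [Var v * P]"]) auto
qed

text \<open>Provable equations \<open>P = 0\<close>; these may be multiplied by arbitrary polynomials.\<close>

definition vanishes :: "nat \<Rightarrow> polynomial set \<Rightarrow> nat \<Rightarrow> nat \<Rightarrow> polynomial \<Rightarrow> bool" where
  "vanishes n K w e P \<longleftrightarrow> derives n K w e P \<and> derives n K w e (- P)"

lemma vanishes_pos: "vanishes n K w e P \<Longrightarrow> 2 \<le> w"
  by (auto simp: vanishes_def intro: weighted_pos derives_weighted)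

lemma vanishes_mono: "vanishes n K w e P \<Longrightarrow> w \<le> w' \<Longrightarrow> e \<le> e' \<Longrightarrow> vanishes n K w' e' P"
  by (auto simp: vanishes_def intro: derives_mono)

lemma vanishes_uminus: "vanishes n K w e P \<Longrightarrow> vanishes n K w e (- P)"
  by (simp add: vanishes_def)

lemma vanishes_add:
  assumes "vanishes n K w1 e P" "vanishes n K w2 e Q" "w1 + w2 + 1 \<le> w"
  shows "vanishes n K w e (P + Q)"
  using derives.add[of n K w1 e P w2 Q w] derives.add[of n K w1 e "- P" w2 "- Q" w] assms
  by (simp add: vanishes_def)

text \<open>The calculus multiplies only by variables and positive constants. With both signs of
  \<open>P\<close> at hand, sums and constants of any sign are possible too, so the induction
  follows the construction of the multiplier \<open>R\<close>.\<close>

lemma vanishes_mult: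
  "weighted n w e R \<Longrightarrow> vanishes n K k d P \<Longrightarrow> vanishes n K (w * k) (d + e) (R * P)"
proof (induction arbitrary: k d P rule: weighted.induct)
  case (const c w e)
  have k: "2 \<le> k" using const by (auto intro: vanishes_pos)
  have w: "(nat \<bar>c\<bar> + 3) * k \<le> w * k" using const by (intro mult_le_mono1)
  have d: "derives n K k (d + e) P" "derives n K k (d + e) (- P)"
    using const by (auto simp: vanishes_def intro: derives_mono)
  consider "c = 0" | "c > 0" | "c < 0" by linarith
  then show ?case
  proof cases
    case 1
    have "3 * k \<le> w * k" using const by (intro mult_le_mono1) linarith
    \<comment> \<open>The rule \<open>scale\<close> needs a positive factor, so the product with
      \<open>0\<close> is obtained by cancelling \<open>P\<close> against
      \<open>- P\<close>.\<close>
    then have "derives n K (w * k) (d + e) (P + - P)"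
      using k by (intro derives.add[OF d]) linarith
    then show ?thesis by (simp add: 1 vanishes_def)
  next
    case 2
    then have "(of_int c :: polynomial) = of_nat (nat c)" by (simp add: of_nat_nat)
    then show ?thesis
      using 2 w derives.scale[OF d(1), of "nat c" "w * k"] derives.scale[OF d(2), of "nat c" "w * k"]
      by (simp add: vanishes_def)
  next
    case 3
    then have "(of_int c :: polynomial) = - of_nat (nat (- c))" by (simp add: of_nat_nat)
    then show ?thesis
      using 3 w derives.scale[OF d(1), of "nat (- c)" "w * k"]
        derives.scale[OF d(2), of "nat (- c)" "w * k"]
      by (simp add: vanishes_def)
  qed
next
  case (var v w e)
  have "2 * k \<le> w * k" using var by (intro mult_le_mono1)
  then show ?case using var derives.times_var[of n K k d P v "w * k" "d + e"]
      derives.times_var[of n K k d "- P" v "w * k" "d + e"] by (simp add: vanishes_def)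
next
  case (add w1 e P' w2 Q w)
  have "(w1 + w2 + 1) * k \<le> w * k" using add.hyps by (intro mult_le_mono1)
  then have "w1 * k + w2 * k + 1 \<le> w * k"
    using vanishes_pos[OF add.prems] by (simp add: algebra_simps)
  then show ?case using vanishes_add[OF add.IH(1)[OF add.prems] add.IH(2)[OF add.prems]]
    by (simp add: algebra_simps)
next
  case (mult w1 e1 P' w2 e2 Q w e)
  have w: "w1 * (w2 * k) \<le> w * k"
    using mult.hyps by (simp add: mult_le_mono1 flip: mult.assoc)
  have "vanishes n K (w1 * (w2 * k)) (d + e2 + e1) (P' * (Q * P))"
    by (intro mult.IH mult.prems)
  then show ?case using w mult.hyps by (auto simp: mult.assoc intro: vanishes_mono)
qed

lemma derives_add_vanishes:
  assumes "derives n K w1 e P" "vanishes n K w2 e Q" "w1 + w2 + 1 \<le> w"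
  shows "derives n K w e (P + Q)"
  using assms by (auto simp: vanishes_def intro: derives.add)


subsection \<open>Reasoning by cases in low degree\<close>

lemma weighted_uminus: "weighted n w e P \<Longrightarrow> 4 * w \<le> w' \<Longrightarrow> weighted n w' e (- P)"
  using weighted.mult[OF weighted.const[of "-1" 4 n 0], of w e P w' e] by simp

lemma weighted_diff:
  assumes "weighted n w1 e P" "weighted n w2 e Q" "w1 + 4 * w2 + 1 \<le> w"
  shows "weighted n w e (P - Q)"
  using weighted.add[OF assms(1) weighted_uminus[OF assms(2) order_refl] assms(3)] by simp

lemma weighted_one: "4 \<le> w \<Longrightarrow> weighted n w e 1"
  using weighted.const[of 1 w n e] by simp

lemma weighted_add_of_int:
  "weighted n k e P \<Longrightarrow> k + nat \<bar>c\<bar> + 4 \<le> w \<Longrightarrow> weighted n w e (P + of_int c)"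
  by (rule weighted.add[OF _ weighted.const[OF order_refl]]) auto

lemma weighted_sum:
  assumes "\<And>i. i \<in> I \<Longrightarrow> weighted n w e (f i)" "finite I"
  shows "weighted n (card I * (w + 1) + 3) e (sum f I)"
  using assms(2,1)
proof (induction I rule: finite_induct)
  case empty
  then show ?case using weighted.const[of 0 3 n e] by simp
next
  case (insert i I)
  then show ?case
    using weighted.add[of n w e "f i" "card I * (w + 1) + 3" "sum f I"] by simp
qed

section \<open>Equations that follow from the Boolean and complement axioms\<close>

lemma vanishes_axiom:
  assumes "P \<in> ls_axioms n" "- P \<in> ls_axioms n" "weighted n k e P" "4 * k \<le> w"
  shows "vanishes n K w e P"
  unfolding vanishes_def
proof
  show "derives n K w e P"
    using assms by (intro derives.base weighted_mono[OF assms(3)]) auto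
  show "derives n K w e (- P)"
    using assms by (intro derives.base weighted_uminus[OF assms(3)]) auto
qed

lemma pvars_iff [simp]: "X i \<in> pvars n \<longleftrightarrow> i \<in> {1..n}" "Xbar i \<in> pvars n \<longleftrightarrow> i \<in> {1..n}"
  by (auto simp: pvars_def)

lemma vanishes_idempotence:
  assumes "v \<in> pvars n"
  shows "vanishes n K 52 2 (Var v * Var v - Var v)"
proof -
  have v: "weighted n 2 1 (Var v)" "weighted n 2 2 (Var v)"
    using assms by (auto intro: weighted.var)
  have w: "weighted n 13 2 (Var v * Var v - Var v)"
    by (rule weighted_diff[OF weighted.mult[OF v(1) v(1) order_refl] v(2)]) auto
  have "Var v * Var v - Var v \<in> ls_axioms n" "- (Var v * Var v - Var v) \<in> ls_axioms n"
    unfolding ls_axioms_def power2_eq_square using assms by blast+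
  then show ?thesis by (rule vanishes_axiom[OF _ _ w]) simp
qed

lemma vanishes_complement:
  assumes "i \<in> {1..n}"
  shows "vanishes n K 40 1 (Var (X i) + Var (Xbar i) - 1)"
proof -
  have v: "weighted n 2 1 (Var (X i))" "weighted n 2 1 (Var (Xbar i))"
    using assms by (auto intro!: weighted.var)
  have w: "weighted n 10 1 (Var (X i) + Var (Xbar i) - 1)"
    using weighted_add_of_int[OF weighted.add[OF v order_refl], of "-1" 10] by simp
  have "Var (X i) + Var (Xbar i) - 1 \<in> ls_axioms n"
       "- (Var (X i) + Var (Xbar i) - 1) \<in> ls_axioms n"
    unfolding ls_axioms_def using assms by blast+
  then show ?thesis by (rule vanishes_axiom[OF _ _ w]) simp
qed

text \<open>The complement equation times \<open>Xbar i\<close> contains the square of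
  \<open>Xbar i\<close>; idempotence of \<open>Xbar i\<close> removes everything but the
  product.\<close>

lemma vanishes_twin_product:
  assumes "i \<in> {1..n}"
  shows "vanishes n K 150 2 (Var (Xbar i) * Var (X i))"
proof -
  have v: "weighted n 2 1 (Var (Xbar i))"
    using assms by (auto intro!: weighted.var)
  have "vanishes n K 80 2 (Var (Xbar i) * (Var (X i) + Var (Xbar i) - 1))"
    by (rule vanishes_mono[OF vanishes_mult[OF v vanishes_complement[OF assms]]]) auto
  moreover have "vanishes n K 52 2 (- (Var (Xbar i) * Var (Xbar i) - Var (Xbar i)))"
    using assms by (intro vanishes_uminus vanishes_idempotence) simp
  ultimately have "vanishes n K 150 2 (Var (Xbar i) * (Var (X i) + Var (Xbar i) - 1) +
     - (Var (Xbar i) * Var (Xbar i) - Var (Xbar i)))"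
    by (rule vanishes_add) simp
  then show ?thesis by (simp add: algebra_simps)
qed

text \<open>Serves empty sums and gaps equal to \<open>0\<close>. The condition
  \<open>1 \<le> n\<close> supplies the variable \<open>X 1\<close>, whose idempotence equation is
  multiplied by \<open>0\<close>.\<close>

lemma vanishes_zero:
  assumes "1 \<le> n" "200 \<le> w" "2 \<le> e"
  shows "vanishes n K w e 0"
proof -
  have "vanishes n K (3 * 52) (2 + 0) (of_int 0 * (Var (X 1) * Var (X 1) - Var (X 1)))"
    using assms by (intro vanishes_mult weighted.const vanishes_idempotence) auto
  then show ?thesis using assms by (auto intro: vanishes_mono)
qed

lemma vanishes_sum:
  assumes "finite I" "\<And>i. i \<in> I \<Longrightarrow> vanishes n K w e (f i)" "1 \<le> n" "200 \<le> w" "2 \<le> e"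
  shows "vanishes n K (card I * (w + 1) + w) e (sum f I)"
  using assms(1,2)
proof (induction I rule: finite_induct)
  case empty
  then show ?case using assms vanishes_zero by simp
next
  case (insert i I)
  have "vanishes n K (card (insert i I) * (w + 1) + w) e (f i + sum f I)"
    by (rule vanishes_add[of n K w e _ "card I * (w + 1) + w"]) (use insert in auto)
  then show ?case using insert.hyps by simp
qed

section \<open>Literals and cube terms\<close>

definition lit :: "nat set \<Rightarrow> nat \<Rightarrow> pvar" where
  "lit T i = (if i \<in> T then X i else Xbar i)"

text \<open>At the \<open>0/1\<close> point where exactly the variables in \<open>T\<close> are
  true, \<open>lit T i\<close> is \<open>1\<close> and \<open>co_lit T i\<close> is
  \<open>0\<close>. For \<open>T \<subseteq> I\<close>, the sum of the latter over \<open>I\<close>,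
  minus \<open>1\<close>, is the inequality attached to \<open>T\<close> in the system.\<close>

definition co_lit :: "nat set \<Rightarrow> nat \<Rightarrow> pvar" where
  "co_lit T i = (if i \<in> T then Xbar i else X i)"

text \<open>The indicator, on \<open>0/1\<close> points, of the assignment to \<open>I\<close> whose set of true variables is
  \<open>I \<inter> T\<close>.\<close>

definition cube_term :: "nat set \<Rightarrow> nat set \<Rightarrow> polynomial" where
  "cube_term I T = (\<Prod>i\<in>I. Var (lit T i))"

lemma lit_pvars: "i \<in> {1..n} \<Longrightarrow> lit T i \<in> pvars n"
  by (simp add: lit_def)

lemma co_lit_pvars: "i \<in> {1..n} \<Longrightarrow> co_lit T i \<in> pvars n"
  by (simp add: co_lit_def)

text \<open>For \<open>i \<in> T\<close> this is idempotence of \<open>X i\<close>, otherwise the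
  product of a variable with its twin.\<close>

lemma vanishes_lit_value:
  assumes "i \<in> {1..n}"
  shows "vanishes n K 150 2 (Var (lit T i) * (Var (X i) - of_bool (i \<in> T)))"
  using vanishes_idempotence[of "X i" n K] vanishes_twin_product[OF assms, of K] assms
  by (auto simp: lit_def algebra_simps intro: vanishes_mono)

lemma vanishes_lit_co_lit:
  assumes "i \<in> {1..n}"
  shows "vanishes n K 150 2 (Var (lit T i) * Var (co_lit T i))"
  using vanishes_twin_product[OF assms, of K]
  by (auto simp: lit_def co_lit_def mult.commute)

lemma weighted_cube_term:
  assumes "finite I" "I \<subseteq> {1..n}"
  shows "weighted n (4 * 2 ^ card I) (card I) (cube_term I T)"
  using assms
proof (induction I rule: finite_induct)
  case empty
  then show ?case by (simp add: cube_term_def weighted_one)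
next
  case (insert i I)
  have "weighted n (4 * 2 ^ card (insert i I)) (card (insert i I)) (Var (lit T i) * cube_term I T)"
    by (rule weighted.mult[OF weighted.var[of _ _ 2 1] insert.IH]) (use insert in \<open>auto intro: lit_pvars\<close>)
  then show ?case using insert.hyps by (simp add: cube_term_def)
qed

lemma derives_cube_term_mult:
  assumes "finite I" "I \<subseteq> {1..n}" "derives n K w e P"
  shows "derives n K (2 ^ card I * w) (e + card I) (cube_term I T * P)"
  using assms(1,2)
proof (induction I rule: finite_induct)
  case empty
  then show ?case using assms by (simp add: cube_term_def)
next
  case (insert i I)
  have "derives n K (2 ^ card (insert i I) * w) (e + card (insert i I))
      (Var (lit T i) * (cube_term I T * P))"
    by (rule derives.times_var[OF insert.IH]) (use insert in \<open>auto intro: lit_pvars\<close>)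
  then show ?case using insert.hyps by (simp add: cube_term_def mult.assoc)
qed

text \<open>One literal already annihilates \<open>R\<close> in degree \<open>2\<close>; the at most
  two others multiply this equation, adding degree \<open>2\<close> and a factor \<open>16\<close>
  in weight.\<close>

lemma vanishes_cube_term_mult:
  assumes "finite I" "I \<subseteq> {1..n}" "card I \<le> 3" "i \<in> I"
    and "vanishes n K 150 2 (Var (lit T i) * R)"
  shows "vanishes n K 2400 4 (cube_term I T * R)"
proof -
  have card: "card (I - {i}) \<le> 2" using assms by simp
  have "(2::nat) ^ card (I - {i}) \<le> 2 ^ 2" using card by (intro power_increasing) auto
  then have "weighted n 16 2 (cube_term (I - {i}) T)"
    using assms card by (intro weighted_mono[OF weighted_cube_term]) auto
  from vanishes_mult[OF this assms(5)]
  have "vanishes n K 2400 4 (cube_term (I - {i}) T * (Var (lit T i) * R))" by simp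
  moreover have "cube_term I T = Var (lit T i) * cube_term (I - {i}) T"
    unfolding cube_term_def using assms by (simp add: prod.remove)
  ultimately show ?thesis by (simp add: ac_simps)
qed

text \<open>Under the cube term each variable may be replaced by its truth value, so a linear form
  may be replaced by its value at the corresponding point.\<close>

lemma vanishes_cube_term_value:
  assumes I: "I \<subseteq> {1..n}" "card I \<le> 3" "T \<subseteq> I" and n: "1 \<le> n" and a: "\<bar>a\<bar> \<le> 2"
  shows "vanishes n K 50000 4 (cube_term I T *
    (of_int a * (\<Sum>i\<in>I. Var (X i)) + of_int b - of_int (a * int (card T) + b)))"
proof -
  have fin: "finite I" using I finite_subset by blast
  have "vanishes n K (card I * (2400 + 1) + 2400) 4
      (\<Sum>i\<in>I. cube_term I T * (Var (X i) - of_bool (i \<in> T)))"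
  proof (rule vanishes_sum[OF fin])
    fix i assume i: "i \<in> I"
    then show "vanishes n K 2400 4 (cube_term I T * (Var (X i) - of_bool (i \<in> T)))"
      using I by (intro vanishes_cube_term_mult[OF fin I(1,2) i] vanishes_lit_value) blast
  qed (use n in auto)
  then have "vanishes n K 10000 4 (\<Sum>i\<in>I. cube_term I T * (Var (X i) - of_bool (i \<in> T)))"
    by (rule vanishes_mono) (use I in auto)
  then have "vanishes n K (5 * 10000) (4 + 0)
      (of_int a * (\<Sum>i\<in>I. cube_term I T * (Var (X i) - of_bool (i \<in> T))))"
    using a by (intro vanishes_mult weighted.const) auto
  moreover have "(\<Sum>i\<in>I. of_bool (i \<in> T) :: polynomial) = of_nat (card T)"
    using fin I(3) by (simp add: Int_absorb1 Int_commute)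
  then have "(\<Sum>i\<in>I. cube_term I T * (Var (X i) - of_bool (i \<in> T))) =
      cube_term I T * ((\<Sum>i\<in>I. Var (X i)) - of_nat (card T))"
    by (simp only: sum_subtractf flip: sum_distrib_left)
  then have "of_int a * (\<Sum>i\<in>I. cube_term I T * (Var (X i) - of_bool (i \<in> T))) =
      cube_term I T * (of_int a * (\<Sum>i\<in>I. Var (X i)) + of_int b - of_int (a * int (card T) + b))"
    by (simp only:) (simp add: algebra_simps)
  ultimately show ?thesis by simp
qed

text \<open>The inequality of \<open>S_system E\<close> for \<open>T\<close> evaluates to \<open>- 1\<close> at the point where exactly the variables in
  \<open>T\<close> are true.\<close>

lemma vanishes_refuted_cube_term:
  assumes I: "I \<subseteq> {1..n}" "card I \<le> 3" "T \<subseteq> I" and n: "1 \<le> n"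
    and K: "(\<Sum>i\<in>T. Var (Xbar i)) + (\<Sum>i\<in>I - T. Var (X i)) - 1 \<in> K"
  shows "vanishes n K 11000 4 (cube_term I T)"
proof -
  have fin: "finite I" using I finite_subset by blast
  have "(2::nat) ^ card I \<le> 2 ^ 3" using I by (intro power_increasing) auto
  then have pow: "(2::nat) ^ card I \<le> 8" by simp
  let ?s = "\<Sum>i\<in>I. Var (co_lit T i)"
  have "?s = (\<Sum>i\<in>T. Var (co_lit T i)) + (\<Sum>i\<in>I - T. Var (co_lit T i))"
    using fin I(3) by (simp add: sum.subset_diff add.commute)
  also have "\<dots> = (\<Sum>i\<in>T. Var (Xbar i)) + (\<Sum>i\<in>I - T. Var (X i))"
    by (simp add: co_lit_def)
  finally have s: "?s - 1 \<in> K" using K by simp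
  have "weighted n (card I * (2 + 1) + 3) 1 ?s"
    using fin I by (intro weighted_sum) (auto intro!: weighted.var co_lit_pvars)
  then have "weighted n 20 1 (?s - 1)"
    using weighted_add_of_int[of n _ 1 ?s "-1" 20] I(2) by simp
  then have "derives n K 20 1 (?s - 1)" using s by (auto intro: derives.base)
  from derives_cube_term_mult[OF fin I(1) this]
  have "derives n K 160 4 (cube_term I T * (?s - 1))"
    by (rule derives_mono) (use pow I in auto)
  moreover have "vanishes n K (card I * (2400 + 1) + 2400) 4
      (\<Sum>i\<in>I. cube_term I T * Var (co_lit T i))"
  proof (rule vanishes_sum[OF fin])
    fix i assume i: "i \<in> I"
    then show "vanishes n K 2400 4 (cube_term I T * Var (co_lit T i))"
      using I by (intro vanishes_cube_term_mult[OF fin I(1,2) i] vanishes_lit_co_lit) blast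
  qed (use n in auto)
  then have "vanishes n K 10000 4 (- (cube_term I T * ?s))"
    unfolding sum_distrib_left by (intro vanishes_uminus) (erule vanishes_mono, use I in auto)
  \<comment> \<open>Each \<open>co_lit\<close> is annihilated by its literal in the cube term, so
    \<open>?s\<close> disappears and \<open>- cube_term I T\<close> remains. The opposite sign is
    the axiom \<open>1\<close> multiplied by the literals.\<close>
  ultimately have "derives n K 11000 4 (cube_term I T * (?s - 1) + - (cube_term I T * ?s))"
    by (rule derives_add_vanishes) simp
  then have "derives n K 11000 4 (- cube_term I T)"
    by (simp add: algebra_simps)
  moreover have "derives n K 4 0 1"
    by (intro derives.base weighted_one) (auto simp: ls_axioms_def)
  then have "derives n K 11000 4 (cube_term I T)"
    using derives_mono[OF derives_cube_term_mult[OF fin I(1)], of K 4 0 1 11000 4 T] pow I by simp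
  ultimately show ?thesis by (simp add: vanishes_def)
qed

text \<open>One variable is eliminated at a time: the cases with \<open>X i\<close> and with
  \<open>Xbar i\<close> are added, and the complement equation replaces \<open>X i + Xbar i\<close>
  by \<open>1\<close>. Each elimination doubles the weight, which is harmless for at most three
  variables.\<close>

lemma derives_by_cases:
  assumes "finite I" "I \<subseteq> {1..n}" "card I \<le> 3" "weighted n w e Q" "e + 3 \<le> f"
    and "\<And>T. T \<subseteq> I \<Longrightarrow> derives n K k f (cube_term I T * Q)"
  shows "derives n K (2 ^ card I * (k + 1280 * w + 2)) f Q"
  using assms(1,2,3,6)
proof (induction I arbitrary: k rule: finite_induct)
  case empty
  have "derives n K k f Q" using empty(3)[of "{}"] by (simp add: cube_term_def)
  then show ?case by (rule derives_mono) simp_all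
next
  case (insert i I)
  have "derives n K (2 * k + 1280 * w + 2) f (cube_term I T * Q)" if T: "T \<subseteq> I" for T
  proof -
    have "i \<notin> T" using T insert.hyps by auto
    have *: "cube_term I (insert i T) = cube_term I T"
      unfolding cube_term_def using insert.hyps by (intro prod.cong) (auto simp: lit_def)
    have 1: "derives n K k f (Var (X i) * cube_term I T * Q)"
      using insert.prems(3)[of "insert i T"] T insert.hyps *
      by (auto simp: cube_term_def lit_def)
    have 2: "derives n K k f (Var (Xbar i) * cube_term I T * Q)"
      using insert.prems(3)[of T] T insert.hyps \<open>i \<notin> T\<close>
      by (auto simp: cube_term_def lit_def)
    have "card I \<le> 2" using insert by simp
    moreover have "(2::nat) ^ card I \<le> 2 ^ 2"
      using \<open>card I \<le> 2\<close> by (intro power_increasing) auto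
    ultimately have "weighted n (16 * w) (2 + e) (cube_term I T * Q)"
      using insert.prems by (intro weighted.mult[OF weighted_mono[OF
          weighted_cube_term[OF insert.hyps(1)], of n 16 2] assms(4)]) auto
    \<comment> \<open>Here \<open>16\<close> bounds the weight of a cube term on at most two
      variables, and \<open>40\<close> is the weight of the complement equation.\<close>
    then have "vanishes n K (16 * w * 40) (1 + (2 + e))
        (cube_term I T * Q * (Var (X i) + Var (Xbar i) - 1))"
      using insert.prems by (intro vanishes_mult vanishes_complement) auto
    then have 3: "vanishes n K (640 * w) f (- (cube_term I T * Q * (Var (X i) + Var (Xbar i) - 1)))"
      using assms(5) by (intro vanishes_uminus) (auto elim!: vanishes_mono)
    have "derives n K (2 * k + 1280 * w + 2) f
       (Var (X i) * cube_term I T * Q + Var (Xbar i) * cube_term I T * Q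
        + - (cube_term I T * Q * (Var (X i) + Var (Xbar i) - 1)))"
      by (rule derives_add_vanishes[OF derives.add[OF 1 2 order_refl] 3]) simp
    then show ?thesis by (simp add: algebra_simps)
  qed
  then have "derives n K (2 ^ card I * (2 * k + 1280 * w + 2 + 1280 * w + 2)) f Q"
    using insert by (intro insert.IH) auto
  then show ?case using insert.hyps by (simp add: algebra_simps)
qed


subsection \<open>Integrality of even forms\<close>

text \<open>Nonnegative at every point where \<open>M / 2\<close> is an integer.\<close>

definition gap :: "polynomial \<Rightarrow> int \<Rightarrow> polynomial" where
  "gap M d = (M - of_int (2 * d)) * (M - of_int (2 * d + 2))"

text \<open>For \<open>H = S_system E\<close> the form \<open>D\<close> takes an even value at each \<open>0/1\<close> point not excluded by \<open>H\<close>.\<close>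

definition even_form :: "nat \<Rightarrow> polynomial set \<Rightarrow> polynomial \<Rightarrow> bool" where
  "even_form n H D \<longleftrightarrow> (\<exists>I a b. I \<subseteq> {1..n} \<and> card I \<le> 3 \<and> \<bar>a\<bar> \<le> 2 \<and> \<bar>b\<bar> \<le> 1 \<and>
     D = of_int a * (\<Sum>i\<in>I. Var (X i)) + of_int b \<and>
     (\<forall>T\<subseteq>I. (\<exists>y. \<bar>y\<bar> \<le> 1 \<and> a * int (card T) + b = 2 * y) \<or>
        (\<Sum>i\<in>T. Var (Xbar i)) + (\<Sum>i\<in>I - T. Var (X i)) - 1 \<in> H))"

lemma weighted_even_form:
  assumes "even_form n H D"
  shows "weighted n 70 1 D"
proof -
  obtain I a b where I: "I \<subseteq> {1..n}" "card I \<le> 3" and ab: "\<bar>a\<bar> \<le> 2" "\<bar>b\<bar> \<le> 1"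
    and D: "D = of_int a * (\<Sum>i\<in>I. Var (X i)) + of_int b"
    using assms unfolding even_form_def by blast
  have fin: "finite I" using I finite_subset by blast
  have "weighted n (card I * (2 + 1) + 3) 1 (\<Sum>i\<in>I. Var (X i))"
    using fin I by (intro weighted_sum) (auto intro!: weighted.var)
  then have "weighted n 12 1 (\<Sum>i\<in>I. Var (X i))"
    by (rule weighted_mono) (use I in auto)
  then have "weighted n 60 1 (of_int a * (\<Sum>i\<in>I. Var (X i)))"
    using ab by (intro weighted.mult[OF weighted.const[of a 5 n 0]]) auto
  then show ?thesis unfolding D by (rule weighted_add_of_int) (use ab in auto)
qed

lemma weighted_gap:
  assumes "weighted n s 1 M" "s + 2 * nat \<bar>d\<bar> + 6 \<le> r"
  shows "weighted n (r^2) 2 (gap M d)"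
proof -
  have "weighted n r 1 (M + of_int (- (2 * d)))"
    by (rule weighted_add_of_int[OF assms(1)]) (use assms(2) in linarith)
  moreover have "weighted n r 1 (M + of_int (- (2 * d + 2)))"
    by (rule weighted_add_of_int[OF assms(1)]) (use assms(2) in linarith)
  ultimately show ?thesis unfolding gap_def
    by (intro weighted.mult[of n r 1 _ r 1]) (simp_all add: power2_eq_square algebra_simps)
qed

text \<open>By cases over the variables of \<open>D\<close>. Where \<open>D\<close> has the value
  \<open>2 * y\<close>, the claim is the premise for \<open>d - y\<close>. Where the system excludes
  the point, the cube term vanishes in degree \<open>4\<close>, and multiplying by the quadratic gap
  gives the degree \<open>6\<close>.\<close>

lemma derives_gap_step:
  assumes n: "1 \<le> n" and D: "even_form n H D" and HK: "H \<subseteq> K"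
    and M: "weighted n s 1 M" and d: "nat \<bar>d\<bar> + 1 \<le> r"
    and prem: "\<And>d'. nat \<bar>d'\<bar> \<le> r \<Longrightarrow> gap M d' \<in> K"
  shows "derives n K (1000000 * (s + 2 * r + 100)^2) 6 (gap (M + D) d)"
proof -
  note wD = weighted_even_form[OF D]
  obtain I a b where I: "I \<subseteq> {1..n}" "card I \<le> 3" and ab: "\<bar>a\<bar> \<le> 2" "\<bar>b\<bar> \<le> 1"
    and D_eq: "D = of_int a * (\<Sum>i\<in>I. Var (X i)) + of_int b"
    and cases: "\<And>T. T \<subseteq> I \<Longrightarrow> (\<exists>y. \<bar>y\<bar> \<le> 1 \<and> a * int (card T) + b = 2 * y) \<or>
        (\<Sum>i\<in>T. Var (Xbar i)) + (\<Sum>i\<in>I - T. Var (X i)) - 1 \<in> H"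
    using D unfolding even_form_def by blast
  have fin: "finite I" using I finite_subset by blast
  have "(2::nat) ^ card I \<le> 2 ^ 3" using I by (intro power_increasing) auto
  then have pow: "(2::nat) ^ card I \<le> 8" by simp
  \<comment> \<open>\<open>q\<close> dominates the weights of the linear factors of the gaps below,
    hence \<open>w\<close> those of the gaps.\<close>
  define q where "q = s + 2 * r + 100"
  define w where "w = q\<^sup>2"
  have "q * 1 \<le> q * q" by (intro mult_le_mono) (auto simp: q_def)
  then have qw: "q \<le> w" by (simp add: w_def power2_eq_square)
  have "weighted n (s + 71) 1 (M + D)" by (rule weighted.add[OF M wD]) simp
  then have wQ: "weighted n w 2 (gap (M + D) d)"
    unfolding w_def by (rule weighted_gap) (use d in \<open>simp add: q_def\<close>)
  have "derives n K (60000 * w) 6 (cube_term I T * gap (M + D) d)" if T: "T \<subseteq> I" for T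
    using cases[OF T]
  proof
    assume "\<exists>y. \<bar>y\<bar> \<le> 1 \<and> a * int (card T) + b = 2 * y"
    then obtain y where y: "\<bar>y\<bar> \<le> 1" "a * int (card T) + b = 2 * y" by blast
    have "gap M (d - y) \<in> K" using y d by (intro prem) linarith
    moreover have "weighted n w 2 (gap M (d - y))"
      unfolding w_def by (rule weighted_gap[OF M]) (use y d in \<open>simp add: q_def\<close>)
    ultimately have "derives n K w 2 (gap M (d - y))" by (auto intro: derives.base)
    from derives_cube_term_mult[OF fin I(1) this]
    have 1: "derives n K (8 * w) 6 (cube_term I T * gap M (d - y))"
      by (rule derives_mono) (use pow I in auto)
    \<comment> \<open>This is the cofactor of \<open>D - 2 * y\<close> in the difference
      \<open>gap (M + D) d - gap M (d - y)\<close>.\<close>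
    have "weighted n w 1 (M + M + D + of_int (2 * y - 4 * d - 2))"
    proof (rule weighted_mono)
      show "weighted n (2 * s + 72 + nat \<bar>2 * y - 4 * d - 2\<bar> + 4) 1
          (M + M + D + of_int (2 * y - 4 * d - 2))"
        by (rule weighted_add_of_int[OF weighted.add[OF weighted.add[OF M M order_refl] wD order_refl]]) simp
      have "2 * s + 72 + nat \<bar>2 * y - 4 * d - 2\<bar> + 4 \<le> 2 * q" using y d by (simp add: q_def)
      also have "2 * q \<le> q * q" by (intro mult_le_mono) (auto simp: q_def)
      finally show "2 * s + 72 + nat \<bar>2 * y - 4 * d - 2\<bar> + 4 \<le> w"
        by (simp add: w_def power2_eq_square)
    qed simp
    from vanishes_mult[OF this vanishes_cube_term_value[OF I T n ab(1), of K b]]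
    have 2: "vanishes n K (50000 * w) 6 ((M + M + D + of_int (2 * y - 4 * d - 2)) *
        (cube_term I T * (D - of_int (2 * y))))"
      unfolding D_eq[symmetric] y(2) by (rule vanishes_mono) auto
    have "cube_term I T * gap M (d - y) + (M + M + D + of_int (2 * y - 4 * d - 2)) *
        (cube_term I T * (D - of_int (2 * y))) = cube_term I T * gap (M + D) d"
      by (simp add: gap_def algebra_simps)
    moreover have "8 * w + 50000 * w + 1 \<le> 60000 * w" using qw by (simp add: q_def)
    ultimately show ?thesis using derives_add_vanishes[OF 1 2] by metis
  next
    assume "(\<Sum>i\<in>T. Var (Xbar i)) + (\<Sum>i\<in>I - T. Var (X i)) - 1 \<in> H"
    then have "vanishes n K 11000 4 (cube_term I T)"
      using HK by (intro vanishes_refuted_cube_term[OF I T n]) auto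
    from vanishes_mult[OF wQ this]
    have "vanishes n K (60000 * w) 6 (gap (M + D) d * cube_term I T)"
      by (rule vanishes_mono) auto
    then show ?thesis by (simp add: vanishes_def mult.commute)
  qed
  then have "derives n K (2 ^ card I * (60000 * w + 1280 * w + 2)) 6 (gap (M + D) d)"
    by (intro derives_by_cases[OF fin I wQ]) auto
  moreover have "2 ^ card I * (60000 * w + 1280 * w + 2) \<le> 8 * (60000 * w + 1280 * w + 2)"
    using pow by (intro mult_le_mono1)
  moreover have "8 * (60000 * w + 1280 * w + 2) \<le> 1000000 * w" using qw by (simp add: q_def)
  ultimately show ?thesis unfolding w_def q_def by (meson derives_mono order_refl order_trans)
qed

section \<open>Iteration over a list of even forms\<close>

lemma ls_derivation_many:
  assumes "finite Qset" "\<And>Q. Q \<in> Qset \<Longrightarrow> derives n (H \<union> A) w e Q"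
  shows "\<exists>Ps. ls_derivation n H A Ps \<and> Qset \<subseteq> A \<union> set Ps \<and> length Ps \<le> card Qset * w \<and>
    (\<forall>P\<in>set Ps. weighted n w e P)"
  using assms
proof (induction Qset rule: finite_induct)
  case empty
  then show ?case by (intro exI[of _ "[]"]) simp
next
  case (insert Q Qset)
  obtain Ps where Ps: "ls_derivation n H A Ps" "Qset \<subseteq> A \<union> set Ps" "length Ps \<le> card Qset * w"
    "\<forall>P\<in>set Ps. weighted n w e P" using insert by auto
  obtain Qs where Qs: "ls_derivation n H A Qs" "Q \<in> A \<union> set Qs" "length Qs \<le> w"
    "\<forall>P\<in>set Qs. weighted n w e P"
    using derives_imp_ls_derivation[of n H A w e Q] insert.prems by auto
  have "ls_derivation n H A (Ps @ Qs)"
    by (rule ls_derivation_append[OF Ps(1) Qs(1)]) simp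
  then show ?case using Ps Qs insert.hyps by (intro exI[of _ "Ps @ Qs"]) auto
qed

text \<open>The gap is the constant \<open>4 * d * (d + 1)\<close>, nonnegative because no integer
  lies strictly between \<open>d\<close> and \<open>d + 1\<close>. It is a positive multiple of the
  axiom \<open>1\<close>, or zero and then derived separately.\<close>

lemma derives_gap_zero:
  assumes "1 \<le> n" "nat \<bar>d\<bar> \<le> r"
  shows "derives n K (1000000 * (r + 1)^2) 6 (gap 0 d)"
proof -
  have gap: "gap 0 d = of_int (4 * d * (d + 1))"
    by (simp add: gap_def algebra_simps)
  have nonneg: "0 \<le> d * (d + 1)"
    by (cases "d \<ge> 0") (auto intro: mult_nonneg_nonneg mult_nonpos_nonpos)
  have "d * (d + 1) \<le> \<bar>d\<bar> * \<bar>d + 1\<bar>" by (simp flip: abs_mult)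
  also have "\<dots> \<le> int (r + 1) * int (r + 1)" using assms by (intro mult_mono) auto
  also have "\<dots> = int ((r + 1)\<^sup>2)" by (simp add: power2_eq_square algebra_simps)
  finally have le: "d * (d + 1) \<le> int ((r + 1)\<^sup>2)" .
  have one: "1 \<le> (r + 1)\<^sup>2" by simp
  show ?thesis
  proof (cases "d * (d + 1) = 0")
    case True
    then have "gap 0 d = of_int 0" unfolding gap mult.assoc by (simp only: mult_zero_right)
    then have "gap 0 d = 0" by simp
    moreover have "vanishes n K (1000000 * (r + 1)^2) 6 0"
      using assms one by (intro vanishes_zero) linarith+
    ultimately show ?thesis by (simp add: vanishes_def)
  next
    case False
    have "derives n K 4 6 1"
      by (intro derives.base weighted_one) (auto simp: ls_axioms_def)
    then have "derives n K (1000000 * (r + 1)^2) 6 (of_nat (nat (4 * (d * (d + 1)))) * 1)"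
    proof (rule derives.scale)
      show "0 < nat (4 * (d * (d + 1)))" using False nonneg by linarith
      show "(nat (4 * (d * (d + 1))) + 3) * 4 \<le> 1000000 * (r + 1)^2"
      proof -
        obtain k where k: "d * (d + 1) = int k" using nonneg by (rule nonneg_int_cases)
        then have "k \<le> (r + 1)\<^sup>2" using le by (simp only: of_nat_le_iff)
        moreover have "nat (4 * (d * (d + 1))) = 4 * k" unfolding k by simp
        moreover have "(4 * k + 3) * 4 \<le> 1000000 * q" if "k \<le> q" "1 \<le> q" for q
          using that by simp
        ultimately show ?thesis using one by metis
      qed
    qed
    moreover have "of_nat (nat (4 * (d * (d + 1)))) * 1 = gap 0 d"
      unfolding gap using nonneg by (simp add: of_nat_nat algebra_simps)
    ultimately show ?thesis by simp
  qed
qed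

text \<open>Adding a form to \<open>M\<close> consumes the inequalities for \<open>d - 1\<close>, \<open>d\<close> and \<open>d + 1\<close>, so the available range
  of \<open>d\<close> shrinks by one in each step.\<close>

lemma ls_derivation_gaps:
  assumes "1 \<le> n" "\<forall>D\<in>set Ds. even_form n H D" "length Ds + r \<le> z"
  defines "w \<equiv> 1000000 * (71 * z + 105)^2"
  shows "weighted n (71 * length Ds + 3) 1 (sum_list Ds) \<and>
    (\<exists>Ps. ls_derivation n H {} Ps \<and> gap (sum_list Ds) ` {- int r..int r} \<subseteq> set Ps \<and>
      length Ps \<le> (length Ds + 1) * ((2 * z + 1) * w) \<and> (\<forall>P\<in>set Ps. weighted n w 6 P))"
  using assms(2,3)
proof (induction Ds arbitrary: r)
  case Nil
  have "derives n (H \<union> {}) w 6 Q" if Q: "Q \<in> gap 0 ` {- int r..int r}" for Q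
  proof -
    obtain d where d: "Q = gap 0 d" "d \<in> {- int r..int r}" using Q by blast
    have "nat \<bar>d\<bar> \<le> r" using d by auto
    from derives_gap_zero[OF assms(1) this, of "H \<union> {}"]
    have "derives n (H \<union> {}) (1000000 * (r + 1)^2) 6 (gap 0 d)" .
    then show ?thesis unfolding d w_def
      by (rule derives_mono) (use Nil in \<open>auto intro!: power_mono mult_le_mono2\<close>)
  qed
  then obtain Ps where Ps: "ls_derivation n H {} Ps" "gap 0 ` {- int r..int r} \<subseteq> set Ps"
    "length Ps \<le> card (gap 0 ` {- int r..int r}) * w" "\<forall>P\<in>set Ps. weighted n w 6 P"
    using ls_derivation_many[of "gap 0 ` {- int r..int r}" n H "{}" w 6] by auto
  have "card (gap 0 ` {- int r..int r}) \<le> card {- int r..int r}" by (rule card_image_le) simp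
  also have "\<dots> \<le> 2 * z + 1" using Nil by simp
  finally have "card (gap 0 ` {- int r..int r}) * w \<le> (2 * z + 1) * w" by (rule mult_le_mono1)
  moreover have "weighted n 3 1 0" using weighted.const[of 0 3 n 1] by simp
  ultimately show ?case using Ps by (auto intro!: exI[of _ Ps])
next
  case (Cons D Ds)
  let ?M = "sum_list Ds"
  have D: "even_form n H D" and r: "length Ds + (r + 1) \<le> z" using Cons.prems by auto
  obtain Ps where M: "weighted n (71 * length Ds + 3) 1 ?M"
    and Ps: "ls_derivation n H {} Ps" "gap ?M ` {- int (r + 1)..int (r + 1)} \<subseteq> set Ps"
    "length Ps \<le> (length Ds + 1) * ((2 * z + 1) * w)" "\<forall>P\<in>set Ps. weighted n w 6 P"
    \<comment> \<open>One form fewer and a range wider by one leave \<open>length Ds + r\<close>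
      unchanged, so the same bound \<open>w\<close> serves at every stage.\<close>
    using Cons.IH[of "r + 1"] Cons.prems r by auto
  let ?Q = "gap (sum_list (D # Ds)) ` {- int r..int r}"
  \<comment> \<open>The lines of \<open>Ps\<close> serve as premises and are not derived again, so
    the lengths of the stages add up instead of multiplying.\<close>
  have "derives n (H \<union> set Ps) w 6 Q" if Q: "Q \<in> ?Q" for Q
  proof -
    obtain d where d: "Q = gap (?M + D) d" "d \<in> {- int r..int r}"
      using Q by (auto simp: add.commute)
    have "gap ?M d' \<in> H \<union> set Ps" if "nat \<bar>d'\<bar> \<le> r + 1" for d'
    proof -
      have "d' \<in> {- int (r + 1)..int (r + 1)}" using that by auto
      then show ?thesis using Ps(2) by blast
    qed
    moreover have "nat \<bar>d\<bar> + 1 \<le> r + 1" using d by auto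
    ultimately have "derives n (H \<union> set Ps)
        (1000000 * (71 * length Ds + 3 + 2 * (r + 1) + 100)^2) 6 (gap (?M + D) d)"
      by (intro derives_gap_step[OF assms(1) D _ M]) auto
    then show ?thesis unfolding d w_def
      by (rule derives_mono) (use r in \<open>auto intro!: power_mono mult_le_mono2\<close>)
  qed
  then obtain Qs where Qs: "ls_derivation n H (set Ps) Qs" "?Q \<subseteq> set Ps \<union> set Qs"
    "length Qs \<le> card ?Q * w" "\<forall>P\<in>set Qs. weighted n w 6 P"
    using ls_derivation_many[of ?Q n H "set Ps" w 6] by auto
  have "card ?Q \<le> card {- int r..int r}" by (rule card_image_le) simp
  also have "\<dots> \<le> 2 * z + 1" using r by simp
  finally have "card ?Q * w \<le> (2 * z + 1) * w" by (rule mult_le_mono1)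
  then have "length Qs \<le> (2 * z + 1) * w" using Qs(3) by (rule order_trans[rotated])
  with Ps(3) have "length Ps + length Qs \<le> (length Ds + 1) * ((2 * z + 1) * w) + (2 * z + 1) * w"
    by (rule add_mono)
  then have "length (Ps @ Qs) \<le> (length (D # Ds) + 1) * ((2 * z + 1) * w)"
    by (simp add: add.commute)
  moreover have "ls_derivation n H {} (Ps @ Qs)"
    by (rule ls_derivation_append[OF Ps(1) Qs(1)]) simp
  moreover have "weighted n (71 * length (D # Ds) + 3) 1 (sum_list (D # Ds))"
    unfolding sum_list.Cons by (rule weighted.add[OF weighted_even_form[OF D] M]) simp
  ultimately show ?case using Ps(4) Qs(2,4)
    by (intro conjI exI[of _ "Ps @ Qs"]) auto
qed


subsection \<open>Parity certificates and refutations\<close>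

lemma of_nat_bit_eq_of_bool: "(of_nat k :: bit) = of_bool (odd k)"
  by (induction k) auto

text \<open>If \<open>T\<close> has the parity demanded by the equation, the form has the value
  \<open>0\<close> or \<open>2\<close> there, since \<open>card T \<le> 3\<close>; otherwise the
  inequality for \<open>T\<close> belongs to the system.\<close>

lemma even_form_equation:
  assumes "(I, \<beta>) \<in> E" "I \<subseteq> {1..n}" "card I \<le> 3"
  shows "even_form n (S_system E) ((\<Sum>i\<in>I. Var (X i)) - of_bool (\<beta> = 1))"
proof -
  have "(\<exists>y. \<bar>y\<bar> \<le> 1 \<and> 1 * int (card T) + (if \<beta> = 1 then -1 else 0) = 2 * y) \<or>
        (\<Sum>i\<in>T. Var (Xbar i)) + (\<Sum>i\<in>I - T. Var (X i)) - 1 \<in> S_system E" if T: "T \<subseteq> I" for T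
  proof (cases "odd (card T) \<longleftrightarrow> \<beta> = 1")
    case True
    have "finite I" using assms(2) finite_subset by blast
    then have "card T \<le> 3" using assms(3) card_mono[OF _ T] by linarith
    then have "card T \<in> {0, 1, 2, 3}" by auto
    then have "\<bar>int (card T div 2)\<bar> \<le> 1 \<and>
        1 * int (card T) + (if \<beta> = 1 then -1 else 0) = 2 * int (card T div 2)"
      using True by (cases "\<beta> = 1") auto
    then show ?thesis by blast
  next
    case False
    then have "(of_nat (card T) :: bit) = 1 - \<beta>"
      by (cases \<beta>) (auto simp: of_nat_bit_eq_of_bool)
    then have "(\<Sum>i\<in>T. Var (Xbar i)) + (\<Sum>i\<in>I - T. Var (X i)) - 1 \<in> S_equation (I, \<beta>)"
      unfolding S_equation_def using T by auto
    then show ?thesis using assms(1) unfolding S_system_def by blast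
  qed
  then have cases: "\<forall>T\<subseteq>I. (\<exists>y. \<bar>y\<bar> \<le> 1 \<and> 1 * int (card T) + (if \<beta> = 1 then -1 else 0) = 2 * y) \<or>
        (\<Sum>i\<in>T. Var (Xbar i)) + (\<Sum>i\<in>I - T. Var (X i)) - 1 \<in> S_system E" by blast
  show ?thesis unfolding even_form_def
    by (rule exI[of _ I], rule exI[of _ 1], rule exI[of _ "if \<beta> = 1 then -1 else 0"], intro conjI cases)
      (use assms(2,3) in simp_all)
qed

text \<open>Even at every \<open>0/1\<close> point, whatever \<open>H\<close> is. These forms cancel
  the even multiples of \<open>X i\<close> left by summing equations.\<close>

lemma even_form_double_variable:
  assumes "i \<in> {1..n}"
  shows "even_form n H (- 2 * Var (X i))"
proof -
  have "\<exists>y. \<bar>y\<bar> \<le> 1 \<and> - 2 * int (card T) + 0 = 2 * y" if "T \<subseteq> {i}" for T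
    using card_mono[OF _ that] by (intro exI[of _ "- int (card T)"]) simp
  then have cases: "\<forall>T\<subseteq>{i}. (\<exists>y. \<bar>y\<bar> \<le> 1 \<and> - 2 * int (card T) + 0 = 2 * y) \<or>
        (\<Sum>i\<in>T. Var (Xbar i)) + (\<Sum>i\<in>{i} - T. Var (X i)) - 1 \<in> H" by blast
  show ?thesis unfolding even_form_def
    by (rule exI[of _ "{i}"], rule exI[of _ "-2"], rule exI[of _ 0], intro conjI cases)
      (use assms in simp_all)
qed

lemma is_3lin_equation:
  "is_3lin n E \<Longrightarrow> e \<in> E \<Longrightarrow> fst e \<subseteq> {1..n} \<and> card (fst e) \<le> 3"
  by (cases e) (auto simp: is_3lin_def)

text \<open>This is \<open>linear_system_alternative\<close> over \<open>bit\<close>: a coefficient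
  vector is the indicator of a subset \<open>F\<close>, and sums in \<open>bit\<close> are parities
  of cardinalities.\<close>

lemma unsatisfiable_parity_certificate:
  assumes "is_3lin n E" "unsatisfiable E"
  shows "\<exists>F\<subseteq>E. (\<forall>i\<in>{1..n}. even (card {e \<in> F. i \<in> fst e})) \<and> odd (card {e \<in> F. snd e = 1})"
proof -
  have fin: "finite E" using assms(1) by (simp add: is_3lin_def)
  have "\<nexists>x. \<forall>e\<in>E. (\<Sum>i\<in>{1..n}. of_bool (i \<in> fst e) * x i) = snd e"
  proof
    assume "\<exists>x. \<forall>e\<in>E. (\<Sum>i\<in>{1..n}. of_bool (i \<in> fst e) * x i) = snd e"
    then obtain x :: "nat \<Rightarrow> bit" where
      x: "\<And>e. e \<in> E \<Longrightarrow> (\<Sum>i\<in>{1..n}. of_bool (i \<in> fst e) * x i) = snd e" by blast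
    have "(\<Sum>i\<in>fst e. x i) = snd e" if e: "e \<in> E" for e
    proof -
      have "fst e \<subseteq> {1..n}" using is_3lin_equation[OF assms(1) e] ..
      then have "(\<Sum>i\<in>fst e. x i) = (\<Sum>i\<in>{1..n}. of_bool (i \<in> fst e) * x i)"
        by (intro sum.mono_neutral_cong_left) auto
      then show ?thesis using x[OF e] by (rule trans)
    qed
    then have "satisfies x E" unfolding satisfies_def case_prod_beta by blast
    then show False using assms(2) unfolding unsatisfiable_def by blast
  qed
  from linear_system_alternative[OF finite_atLeastAtMost fin this] obtain c :: "equation \<Rightarrow> bit"
    where c: "\<And>i. i \<in> {1..n} \<Longrightarrow> (\<Sum>e\<in>E. c e * of_bool (i \<in> fst e)) = 0"
      "(\<Sum>e\<in>E. c e * snd e) = 1" by blast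
  define F where "F = {e \<in> E. c e = 1}"
  have finF: "finite F" using fin by (simp add: F_def)
  have card: "(\<Sum>e\<in>E. c e * of_bool (P e)) = of_nat (card {e \<in> F. P e})" for P
  proof -
    have "(\<Sum>e\<in>E. c e * of_bool (P e)) = (\<Sum>e\<in>{e \<in> F. P e}. 1)"
    proof (rule sum.mono_neutral_cong_right[OF fin])
      show "\<forall>e\<in>E - {e \<in> F. P e}. c e * of_bool (P e) = 0"
      proof
        fix e assume "e \<in> E - {e \<in> F. P e}"
        then show "c e * of_bool (P e) = 0" by (cases "c e") (auto simp: F_def)
      qed
    qed (auto simp: F_def)
    then show ?thesis by simp
  qed
  have "of_bool (snd e = 1) = snd e" for e :: equation by (cases "snd e") auto
  then have "(\<Sum>e\<in>E. c e * of_bool (snd e = 1)) = 1" using c(2) by (simp only:)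
  then have "odd (card {e \<in> F. snd e = 1})"
    unfolding card of_nat_bit_eq_of_bool by (simp split: if_splits)
  moreover have "even (card {e \<in> F. i \<in> fst e})" if "i \<in> {1..n}" for i
    using c(1)[OF that] unfolding card of_nat_bit_eq_of_bool by (simp split: if_splits)
  ultimately show ?thesis by (intro exI[of _ F]) (auto simp: F_def)
qed

lemma sum_list_concat: "sum_list (concat xss) = (\<Sum>xs\<leftarrow>xss. sum_list xs)"
  by (induction xss) auto

text \<open>With the certificate \<open>F\<close>, the integer forms of its equations sum to
  \<open>k i\<close> copies of each \<open>X i\<close>, minus \<open>B\<close>. As
  \<open>k i\<close> is even, \<open>k i div 2\<close> copies of \<open>- 2 * X i\<close> cancel
  them.\<close>

lemma unsatisfiable_even_forms:
  assumes "is_3lin n E" "unsatisfiable E"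
  shows "\<exists>Ds B. (\<forall>D\<in>set Ds. even_form n (S_system E) D) \<and> sum_list Ds = - of_nat B \<and>
    odd B \<and> B \<le> card E \<and> length Ds \<le> 4 * card E"
proof -
  obtain F where F: "F \<subseteq> E" "\<And>i. i \<in> {1..n} \<Longrightarrow> even (card {e \<in> F. i \<in> fst e})"
    "odd (card {e \<in> F. snd e = 1})" using unsatisfiable_parity_certificate[OF assms] by blast
  have fin: "finite E" using assms(1) by (simp add: is_3lin_def)
  have E: "fst e \<subseteq> {1..n} \<and> card (fst e) \<le> 3" if "e \<in> E" for e
    using is_3lin_equation[OF assms(1) that] .
  have finF: "finite F" using F(1) fin finite_subset by blast
  obtain fs where fs: "set fs = F" "distinct fs" using finite_distinct_list[OF finF] by blast
  define k where "k i = card {e \<in> F. i \<in> fst e}" for i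
  define B where "B = card {e \<in> F. snd e = 1}"
  define Ds :: "polynomial list" where
    "Ds = map (\<lambda>e. (\<Sum>i\<in>fst e. Var (X i)) - of_bool (snd e = 1)) fs @
      concat (map (\<lambda>i. replicate (k i div 2) (- 2 * Var (X i))) [1..<n+1])"
  \<comment> \<open>Used twice: with \<open>Var (X i)\<close> to compute the sum of the forms, and
    with the constant \<open>1\<close> to count them.\<close>
  have double_count: "(\<Sum>e\<in>F. \<Sum>i\<in>fst e. f i) = (\<Sum>i\<in>{1..n}. of_nat (k i) * f i)"
    for f :: "nat \<Rightarrow> 'a::comm_semiring_1"
  proof -
    have "(\<Sum>e\<in>F. \<Sum>i\<in>fst e. f i) = (\<Sum>e\<in>F. \<Sum>i\<in>{1..n}. if i \<in> fst e then f i else 0)"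
    proof (rule sum.cong[OF refl])
      fix e assume "e \<in> F"
      then have "fst e \<subseteq> {1..n}" using E F(1) by blast
      then show "(\<Sum>i\<in>fst e. f i) = (\<Sum>i\<in>{1..n}. if i \<in> fst e then f i else 0)"
        by (intro sum.mono_neutral_cong_left) auto
    qed
    also have "\<dots> = (\<Sum>i\<in>{1..n}. \<Sum>e\<in>F. if i \<in> fst e then f i else 0)" by (rule sum.swap)
    also have "\<dots> = (\<Sum>i\<in>{1..n}. of_nat (k i) * f i)"
      by (rule sum.cong[OF refl]) (simp add: k_def finF flip: sum.inter_filter)
    finally show ?thesis .
  qed
  have "\<forall>D\<in>set Ds. even_form n (S_system E) D"
  proof
    fix D assume "D \<in> set Ds"
    then have "D \<in> (\<lambda>e. (\<Sum>i\<in>fst e. Var (X i)) - of_bool (snd e = 1)) ` F \<or>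
        (\<exists>i\<in>set [1..<n+1]. D \<in> set (replicate (k i div 2) (- 2 * Var (X i))))"
      unfolding Ds_def set_append set_concat set_map fs(1) by blast
    then consider e where "e \<in> F" "D = (\<Sum>i\<in>fst e. Var (X i)) - of_bool (snd e = 1)"
      | i where "i \<in> {1..n}" "D = - 2 * Var (X i)"
      unfolding in_set_replicate set_upt atLeastLessThan_iff atLeastAtMost_iff by fastforce
    then show "even_form n (S_system E) D"
    proof cases
      case 1
      then show ?thesis using E[of e] F(1) even_form_equation[of "fst e" "snd e" E n] by auto
    next
      case 2
      then show ?thesis using even_form_double_variable by blast
    qed
  qed
  moreover have "sum_list Ds = - of_nat B"
  proof -
    have "sum_list Ds = (\<Sum>e\<in>F. (\<Sum>i\<in>fst e. Var (X i)) - of_bool (snd e = 1))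
        + (\<Sum>i\<leftarrow>[1..<n+1]. of_nat (k i div 2) * (- 2 * Var (X i)))"
      unfolding Ds_def sum_list_append sum_list_concat map_map o_def sum_list_replicate
        sum_list_distinct_conv_sum_set[OF fs(2)] fs(1) ..
    also have "(\<Sum>i\<leftarrow>[1..<n+1]. of_nat (k i div 2) * (- 2 * Var (X i)))
        = (\<Sum>i\<in>{1..n}. of_nat (k i div 2) * (- 2 * Var (X i)))"
      by (simp only: interv_sum_list_conv_sum_set_nat set_upt atLeastLessThanSuc_atLeastAtMost flip: Suc_eq_plus1)
    also have "\<dots> = (\<Sum>i\<in>{1..n}. - (of_nat (k i) * Var (X i)))"
    proof (rule sum.cong[OF refl])
      fix i assume i: "i \<in> {1..n}"
      have "k i = 2 * (k i div 2)" using F(2)[OF i] by (simp add: k_def)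
      then have "(of_nat (k i) :: polynomial) = 2 * of_nat (k i div 2)"
        by (metis of_nat_mult of_nat_numeral)
      then show "of_nat (k i div 2) * (- 2 * Var (X i)) = - (of_nat (k i) * Var (X i))"
        by (simp add: algebra_simps)
    qed
    also have "(\<Sum>e\<in>F. (\<Sum>i\<in>fst e. Var (X i)) - of_bool (snd e = 1))
        = (\<Sum>i\<in>{1..n}. of_nat (k i) * Var (X i)) - of_nat B"
      using finF by (simp add: sum_subtractf double_count B_def Int_def)
    finally show ?thesis by (simp add: sum_negf)
  qed
  moreover have "odd B" using F(3) by (simp add: B_def)
  moreover have "B \<le> card E" unfolding B_def using F(1) fin by (intro card_mono) auto
  \<comment> \<open>\<open>card F\<close> forms come from equations; the others number at most the
    incidences of variables in equations, which are at most \<open>3 * card F\<close>.\<close>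
  moreover have "length Ds \<le> 4 * card E"
  proof -
    have cF: "card F \<le> card E" using F(1) fin by (rule card_mono[rotated])
    have "length Ds = length fs + (\<Sum>i\<leftarrow>[1..<n+1]. k i div 2)"
      unfolding Ds_def by (simp add: length_concat o_def)
    also have "length fs = card F" using fs distinct_card by fastforce
    also have "(\<Sum>i\<leftarrow>[1..<n+1]. k i div 2) = (\<Sum>i\<in>{1..n}. k i div 2)"
      by (simp only: interv_sum_list_conv_sum_set_nat set_upt atLeastLessThanSuc_atLeastAtMost flip: Suc_eq_plus1)
    also have "\<dots> \<le> (\<Sum>i\<in>{1..n}. k i)" by (intro sum_mono) simp
    also have "\<dots> = (\<Sum>e\<in>F. card (fst e))" using double_count[of "\<lambda>_. 1 :: nat"] by simp
    also have "\<dots> \<le> (\<Sum>e\<in>F. 3)" using E F(1) by (intro sum_mono) auto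
    finally show ?thesis using cF by simp
  qed
  ultimately show ?thesis by blast
qed

section \<open>Degree and size of the whole refutation\<close>

lemma proof_degree_le:
  assumes "\<forall>P\<in>set Ps. weighted n w e P"
  shows "proof_degree Ps \<le> e"
  using assms by (auto simp: proof_degree_def dest: weighted_bounds(2))

lemma proof_size_le:
  assumes "\<forall>P\<in>set Ps. weighted n w e P"
  shows "proof_size Ps \<le> enat (length Ps * ((4 + e) * w + 3))"
  using assms
proof (induction Ps)
  case (Cons P Ps)
  have "proof_size (P # Ps) = inequality_symbols P + proof_size Ps"
    by (simp add: proof_size_def)
  also have "\<dots> \<le> enat ((4 + e) * w + 3) + enat (length Ps * ((4 + e) * w + 3))"
    using Cons by (intro add_mono inequality_symbols_le) auto
  finally show ?case by simp
qed (simp add: proof_size_def zero_enat_def)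

text \<open>A refutation has to end in \<open>- 1\<close>, so the derivation is cut off right after
  an occurrence of it.\<close>

lemma ls_refutation_prefix:
  assumes "ls_derivation n H {} Ps" "- 1 \<in> set Ps"
  shows "\<exists>Qs. ls_refutation n H Qs \<and> set Qs \<subseteq> set Ps \<and> length Qs \<le> length Ps"
proof -
  obtain j where j: "j < length Ps" "Ps ! j = - 1" using assms(2) by (auto simp: in_set_conv_nth)
  have "ls_refutation n H (take (Suc j) Ps)"
    unfolding ls_refutation_def
  proof (intro conjI)
    show "take (Suc j) Ps \<noteq> []" using j by auto
    show "last (take (Suc j) Ps) = - 1" using j by (simp add: take_Suc_conv_app_nth)
    show "\<forall>i<length (take (Suc j) Ps).
        ls_step n H (set (take i (take (Suc j) Ps))) (take (Suc j) Ps ! i)"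
      using assms(1) by (auto simp: ls_derivation_def min_def)
  qed
  moreover have "set (take (Suc j) Ps) \<subseteq> set Ps" by (rule set_take_subset)
  ultimately show ?thesis by (intro exI[of _ "take (Suc j) Ps"]) simp
qed

text \<open>The number of lines times the symbols per line. The bounds \<open>1 \<le> m\<close> and
  \<open>1 \<le> w\<close> absorb the additive constants into the factors \<open>5\<close>,
  \<open>11\<close> and \<open>13\<close>.\<close>

lemma size_polynomial_bound:
  fixes m :: nat
  assumes "1 \<le> m" "l \<le> 4 * m" "w \<le> k * m\<^sup>2" "1 \<le> w"
  shows "(l + 1) * ((2 * (5 * m) + 1) * w) * ((4 + 6) * w + 3) \<le> 5 * 11 * 13 * k\<^sup>2 * m ^ 6"
proof -
  have "(4 + 6) * w + 3 \<le> 13 * w" using assms(4) by simp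
  also have "\<dots> \<le> 13 * (k * m\<^sup>2)" using assms(3) by (rule mult_le_mono2)
  finally have "(l + 1) * ((2 * (5 * m) + 1) * w) * ((4 + 6) * w + 3)
      \<le> (5 * m) * ((11 * m) * (k * m\<^sup>2)) * (13 * (k * m\<^sup>2))"
    using assms(1-3) by (intro mult_le_mono) auto
  also have "\<dots> = 5 * 11 * 13 * k\<^sup>2 * m ^ 6"
    by (simp add: power_numeral_reduce power2_eq_square)
  finally show ?thesis .
qed

lemma ls_refutation_empty_equation:
  assumes "({}, 1) \<in> E"
  shows "ls_refutation n (S_system E) [- 1]"
proof -
  have "- 1 \<in> S_equation ({}, 1)" by (auto simp: S_equation_def)
  then have "- 1 \<in> S_system E" using assms unfolding S_system_def by blast
  then show ?thesis by (simp add: ls_refutation_def ls_step_def)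
qed

theorem theorem7p4:
  shows "\<exists>c d :: nat. \<forall>(n :: nat) (m :: nat) (E :: equation set).
           is_3lin n E \<and> card E = m \<and> unsatisfiable E \<longrightarrow>
           (\<exists>Ps. ls_refutation n (S_system E) Ps \<and>
                 proof_degree Ps \<le> 6 \<and>
                 proof_size Ps \<le> enat (c * (n + m) ^ d))"
proof -
  \<comment> \<open>The constant \<open>460\<close> is \<open>71 * 5 + 105\<close>, from the weight
    bound of \<open>ls_derivation_gaps\<close> with range parameter
    \<open>5 * card E\<close>.\<close>
  define k :: nat where "k = 1000000 * 460\<^sup>2"
  define c :: nat where "c = 5 * 11 * 13 * k\<^sup>2"
  have "\<exists>Ps. ls_refutation n (S_system E) Ps \<and> proof_degree Ps \<le> 6 \<and>
      proof_size Ps \<le> enat (c * (n + card E) ^ 6)"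
    if lin: "is_3lin n E" and unsat: "unsatisfiable E" for n E
  proof -
    have "E \<noteq> {}" using unsat by (auto simp: unsatisfiable_def satisfies_def)
    then have m: "1 \<le> card E" using lin by (simp add: is_3lin_def Suc_le_eq card_gt_0_iff)
    have "card E ^ 6 \<le> (n + card E) ^ 6" by (intro power_mono) auto
    then have c_le: "c * card E ^ 6 \<le> c * (n + card E) ^ 6" by (rule mult_le_mono2)
    show ?thesis
    proof (cases "n = 0")
      case True
      \<comment> \<open>Without variables all equations have empty left-hand sides, so only
        \<open>0 = 1\<close> can be violated; its inequality for the empty \<open>T\<close> is
        already \<open>- 1 \<ge> 0\<close>.\<close>
      have "({}, 1) \<in> E"
      proof (rule ccontr)
        assume "({}, 1) \<notin> E"
        have "(\<Sum>i\<in>fst e. 0) = snd e" if e: "e \<in> E" for e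
        proof -
          have "fst e = {}" using is_3lin_equation[OF lin e] True by simp
          then show ?thesis using e \<open>({}, 1) \<notin> E\<close> by (cases e; cases "snd e") auto
        qed
        then have "satisfies (\<lambda>_. 0) E" unfolding satisfies_def case_prod_beta by blast
        then show False using unsat unfolding unsatisfiable_def by blast
      qed
      have P: "\<forall>P\<in>set [- 1 :: polynomial]. weighted n 4 0 P"
        using weighted.const[of "-1" 4 n 0] by simp
      \<comment> \<open>\<open>19\<close> is the bound of \<open>proof_size_le\<close> for the
        single line of weight \<open>4\<close> and degree \<open>0\<close>.\<close>
      have "19 \<le> c * 1" by (simp add: c_def k_def)
      also have "\<dots> \<le> c * card E ^ 6" using m by (intro mult_le_mono2) simp
      finally have "19 \<le> c * (n + card E) ^ 6" using c_le by linarith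
      then have "proof_size [- 1] \<le> enat (c * (n + card E) ^ 6)"
        using proof_size_le[OF P] by (simp add: order_trans)
      then show ?thesis
        using ls_refutation_empty_equation[OF \<open>({}, 1) \<in> E\<close>] proof_degree_le[OF P] by force
    next
      case False
      obtain Ds B where Ds: "\<forall>D\<in>set Ds. even_form n (S_system E) D" "sum_list Ds = - of_nat B"
        and B: "odd B" "B \<le> card E" and len: "length Ds \<le> 4 * card E"
        using unsatisfiable_even_forms[OF lin unsat] by blast
      \<comment> \<open>Here \<open>5 * card E\<close> leaves room for at most
        \<open>4 * card E\<close> forms and a final range of radius \<open>card E\<close>.\<close>
      define w where "w = 1000000 * (71 * (5 * card E) + 105)^2"
      obtain Ps where Ps: "ls_derivation n (S_system E) {} Ps"
        "gap (sum_list Ds) ` {- int (card E)..int (card E)} \<subseteq> set Ps"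
        "length Ps \<le> (length Ds + 1) * ((2 * (5 * card E) + 1) * w)"
        "\<forall>P\<in>set Ps. weighted n w 6 P"
        using ls_derivation_gaps[of n Ds "S_system E" "card E" "5 * card E"] False Ds(1) len
        unfolding w_def by auto
      obtain b where b: "B = 2 * b + 1" using B(1) by (rule oddE)
      \<comment> \<open>The odd number \<open>- B\<close> lies midway between the consecutive even
        numbers \<open>- B - 1\<close> and \<open>- B + 1\<close>, so the two factors are
        \<open>1\<close> and \<open>- 1\<close>.\<close>
      have "gap (sum_list Ds) (- int (b + 1)) = - 1"
        unfolding Ds(2) b gap_def by (simp add: algebra_simps)
      moreover have "- int (b + 1) \<in> {- int (card E)..int (card E)}" using b B(2) by auto
      ultimately have "- 1 \<in> set Ps" using Ps(2) by (metis image_subset_iff)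
      from ls_refutation_prefix[OF Ps(1) this] obtain Qs where
        Qs: "ls_refutation n (S_system E) Qs" "set Qs \<subseteq> set Ps" "length Qs \<le> length Ps" by blast
      have Qw: "\<forall>P\<in>set Qs. weighted n w 6 P" using Ps(4) Qs(2) by blast
      have "length Qs * ((4 + 6) * w + 3)
          \<le> (length Ds + 1) * ((2 * (5 * card E) + 1) * w) * ((4 + 6) * w + 3)"
        using Qs(3) Ps(3) by (intro mult_le_mono1) linarith
      also have "\<dots> \<le> c * card E ^ 6"
      proof -
        have "w \<le> 1000000 * (460 * card E)\<^sup>2"
          unfolding w_def using m by (intro mult_le_mono2 power_mono) auto
        then have "w \<le> k * (card E)\<^sup>2" by (simp add: k_def power_mult_distrib)
        then show ?thesis
          unfolding c_def by (rule size_polynomial_bound[OF m len]) (simp add: w_def)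
      qed
      finally have "proof_size Qs \<le> enat (c * (n + card E) ^ 6)"
        using proof_size_le[OF Qw] c_le by (meson enat_ord_simps(1) order_trans)
      then show ?thesis using Qs(1) proof_degree_le[OF Qw] by blast
    qed
  qed
  then show ?thesis by blast
qed

end
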